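(* The quaternary quadratic form $Q_{80}^1=x^2+2y^2+4z^2+10w^2$ primitively represents every positive integer except $24$; that is, for every positive integer $n\neq 24$ there exist $x,y,z,w\in\mathbb{Z}$ with $\gcd(x,y,z,w)=1$ and $x^2+2y^2+4z^2+10w^2=n$, and no such solution exists for $n=24$. *)

theory Defs
  imports Main
begin

type_synonym quaternary_form = "int \<Rightarrow> int \<Rightarrow> int \<Rightarrow> int \<Rightarrow> int"

definition Q80_1 :: quaternary_form where
  "Q80_1 x y z w = x\<^sup>2 + 2 * y\<^sup>2 + 4 * z\<^sup>2 + 10 * w\<^sup>2"

definition primitively_represents :: "quaternary_form \<Rightarrow> int \<Rightarrow> bool" where
  "primitively_represents Q n \<longleftrightarrow>
     (\<exists>x y z w. Gcd {x, y, z, w} = 1 \<and> Q x y z w = n)"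

end

(*
  Everything reduces to sums of three squares.  With w = 1, an odd n needs n - 10 = x^2 + 2y^2 + 4z^2,
  which follows from 2(n - 10) being a sum of three squares; an even n = 2m needs m - 5w^2, with
  w = 1 or 2, to be a sum of three squares, except when m = 4 mod 8, where halving the form twice
  gives a^2 + b^2 + c^2 + 5w^2 = n/8 with a + b odd.  Only the classes 1, 2 mod 4 and 3 mod 8 occur.

  For squarefree N in these classes choose a prime q = 1 mod 4 with prescribed Legendre symbols at the
  odd primes dividing N, so that -eq is a square mod N and N is a square mod eq, where e = 2 for
  N = 3 mod 8 and e = 1 otherwise.  A pigeonhole argument then solves N t^2 = z^2 + eq s^2, and eq is
  a sum of two rational squares, so N is a sum of three rational squares and, by Davenport-Cassels,
  of three integer squares.

  The prime q comes from Dirichlet's argument restricted to products of quadratic characters: the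
  series of psi(n) Lambda(n) n^-s stays bounded as s -> 1 for nonprincipal psi (L(1, psi) is nonzero
  by Monsky's Lambert series argument) and is unbounded for principal psi.
*)
theory Submission
  imports Defs "HOL-Analysis.Infinite_Sum" "HOL-Analysis.Summation_Tests" "HOL-Analysis.Harmonic_Numbers"
    "HOL-Number_Theory.Number_Theory" "HOL-Computational_Algebra.Squarefree"
begin

section \<open>Real characters and their Dirichlet series\<close>

text \<open>The numbers passed to the three squares theorem must avoid multiples of 4 and the class
  7 mod 8. For m - 5 this fails exactly if m = 1 mod 4 or m = 4 mod 8. Replacing w = 1 by w = 2
  repairs the first class, as m - 20 is again 1 mod 4, but in the second it gives 0 mod 8; hence the
  separate treatment of n = 8 M with M odd. The exception 24 lives there: for M = 3 the reduced
  equation a^2 + b^2 + c^2 + 5 w^2 = 3 forces w = 0 and a, b, c odd, so a + b cannot be odd. The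
  auxiliary prime q is 1 mod 4 for two reasons: -1 is then a square mod q, which makes q a sum of
  two rational squares, and reciprocity carries no sign, so that the symbol of N mod q can be read
  off from the symbols prescribed at the primes dividing N. Real characters suffice to find q,
  because signs eps_i are detected by the product of the factors 1 + eps_i f_i(n). Its expansion is
  a sum over subsets of the characters, and the empty subset is the only one whose series diverges
  at s = 1.\<close>

lemma abel_summation_bound:
  fixes c a :: "nat \<Rightarrow> real"
  assumes S: "\<And>n. \<bar>\<Sum>k=m..<n. c k\<bar> \<le> C"
    and anti: "\<And>k. k \<ge> m \<Longrightarrow> a (Suc k) \<le> a k" and nonneg: "\<And>k. k \<ge> m \<Longrightarrow> 0 \<le> a k"
  shows "\<bar>\<Sum>k=m..<n. c k * a k\<bar> \<le> C * a m"
proof (cases "m \<le> n")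
  case True
  define S' where "S' = (\<lambda>n. \<Sum>k=m..<n. c k)"
  \<comment> \<open>Summation by parts. As the weights decrease, their differences are nonnegative
    and telescope.\<close>
  have *: "(\<Sum>k=m..<n. c k * a k) = S' n * a n + (\<Sum>k=m..<n. S' (Suc k) * (a k - a (Suc k)))"
    using True by (induction n rule: dec_induct) (simp_all add: S'_def algebra_simps)
  have telescope: "(\<Sum>k=m..<n. a k - a (Suc k)) = a m - a n"
    using True by (induction n rule: dec_induct) simp_all
  have "\<bar>\<Sum>k=m..<n. c k * a k\<bar> \<le> \<bar>S' n\<bar> * a n + (\<Sum>k=m..<n. \<bar>S' (Suc k)\<bar> * (a k - a (Suc k)))"
    unfolding * using True nonneg anti
    by (intro order.trans[OF abs_triangle_ineq] add_mono order.trans[OF sum_abs] sum_mono)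
       (simp_all add: abs_mult)
  also have "\<dots> \<le> C * a n + (\<Sum>k=m..<n. C * (a k - a (Suc k)))"
    using True nonneg anti S unfolding S'_def by (intro add_mono sum_mono mult_right_mono S) auto
  also have "\<dots> = C * a m"
    unfolding sum_distrib_left[symmetric] telescope by (simp add: algebra_simps)
  finally show ?thesis .
next
  case False
  have "0 \<le> C" using S[of 0] by simp
  thus ?thesis using False nonneg[of m] by simp
qed

lemma infsum_mult_times:
  fixes f :: "'a \<Rightarrow> real" and g :: "'b \<Rightarrow> real"
  assumes "f summable_on A" "g summable_on B"
  shows "(\<lambda>(x, y). f x * g y) summable_on (A \<times> B)"
    and "infsum (\<lambda>(x, y). f x * g y) (A \<times> B) = infsum f A * infsum g B"
proof -
  have fa: "(\<lambda>x. \<bar>f x\<bar>) summable_on A" and ga: "(\<lambda>y. \<bar>g y\<bar>) summable_on B"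
    using assms summable_on_iff_abs_summable_on_real by auto
  have "(\<lambda>(x, y). f x * g y) abs_summable_on (A \<times> B)"
    unfolding abs_summable_on_Sigma_iff using fa ga
    by (auto simp: abs_mult infsum_cmult_right' summable_on_cmult_right intro!: summable_on_cmult_left)
  thus *: "(\<lambda>(x, y). f x * g y) summable_on (A \<times> B)" by (rule abs_summable_summable)
  show "infsum (\<lambda>(x, y). f x * g y) (A \<times> B) = infsum f A * infsum g B"
    using infsum_Sigma'_banach[OF *] by (simp add: infsum_cmult_right' infsum_cmult_left')
qed

text \<open>Regroups a double series by the product of its indices: (d, m) corresponds to n = d m
  together with its divisor d. This turns products of Dirichlet series into convolutions and Lambert
  series into power series.\<close>

lemma infsum_divisor_pairs:
  fixes g :: "nat \<times> nat \<Rightarrow> real"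
  assumes "g summable_on ({0<..} \<times> {0<..})"
  shows "(\<lambda>n. \<Sum>d | d dvd n. g (d, n div d)) summable_on {0<..}"
    and "infsum g ({0<..} \<times> {0<..}) = infsum (\<lambda>n. \<Sum>d | d dvd n. g (d, n div d)) {0<..}"
proof -
  define h where "h = (\<lambda>(n, d). (d, n div d :: nat))"
  have bij: "bij_betw h (SIGMA n:{0<..}. {d. d dvd n}) ({0<..} \<times> {0<..})"
    by (rule bij_betwI[where g = "\<lambda>(d, m). (d * m, d)"])
       (auto simp: h_def dvd_div_eq_0_iff intro!: Nat.gr0I)
  have "(\<lambda>x. g (h x)) summable_on (SIGMA n:{0<..}. {d. d dvd n})"
    using assms summable_on_reindex_bij_betw[OF bij, of g] by simp
  hence *: "(\<lambda>(n, d). g (d, n div d)) summable_on (SIGMA n:{0<..}. {d. d dvd n})"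
    by (simp add: h_def case_prod_unfold)
  have **: "infsum (\<lambda>d. g (d, n div d)) {d. d dvd n} = (\<Sum>d | d dvd n. g (d, n div d))"
    if "n \<in> {0<..}" for n using that by simp
  show "(\<lambda>n. \<Sum>d | d dvd n. g (d, n div d)) summable_on {0<..}"
    using summable_on_Sigma_banach[OF *] by (rule summable_on_cong[THEN iffD1, rotated]) (rule **)
  have "infsum (\<lambda>(n, d). g (d, n div d)) (SIGMA n:{0<..}. {d. d dvd n})
      = infsum (\<lambda>n. infsum (\<lambda>d. g (d, n div d)) {d. d dvd n}) {0<..}"
    using * by (simp add: infsum_Sigma'_banach)
  also have "\<dots> = infsum (\<lambda>n. \<Sum>d | d dvd n. g (d, n div d)) {0<..}"
    by (intro infsum_cong) simp
  also have "infsum (\<lambda>(n, d). g (d, n div d)) (SIGMA n:{0<..}. {d. d dvd n}) = infsum g ({0<..} \<times> {0<..})"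
    using infsum_reindex_bij_betw[OF bij, of g] by (simp add: h_def case_prod_unfold)
  finally show "infsum g ({0<..} \<times> {0<..}) = infsum (\<lambda>n. \<Sum>d | d dvd n. g (d, n div d)) {0<..}" .
qed

lemma summable_on_ln_powr:
  fixes f :: "nat \<Rightarrow> real"
  assumes "s > 1" "\<And>n. n > 0 \<Longrightarrow> \<bar>f n\<bar> \<le> K * (1 + ln n)"
  shows "(\<lambda>n. f n * real n powr - s) summable_on {0<..}"
proof -
  \<comment> \<open>Half of the excess s - 1 absorbs the logarithm; the other half keeps the
    exponent below -1.\<close>
  define \<epsilon> where "\<epsilon> = (s - 1) / 2"
  have \<epsilon>: "\<epsilon> > 0" "- s + \<epsilon> < -1" using assms(1) by (simp_all add: \<epsilon>_def field_simps)
  have K: "K \<ge> 0" using assms(2)[of 1] by simp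
  have "summable (\<lambda>n. \<bar>if n > 0 then f n * real n powr - s else 0\<bar>)"
  proof (rule summable_comparison_test')
    have "summable (\<lambda>n. real n powr (- s + \<epsilon>))" using \<epsilon>(2) by (simp add: summable_real_powr_iff)
    thus "summable (\<lambda>n. K * (1 + 1 / \<epsilon>) * real n powr (- s + \<epsilon>))" by (rule summable_mult)
    fix n :: nat assume "n \<ge> 1"
    hence n: "real n \<ge> 1" by simp
    have "ln (real n) \<le> real n powr \<epsilon> / \<epsilon>" using n \<epsilon>(1) by (intro ln_powr_bound)
    moreover have "1 \<le> real n powr \<epsilon>" using n \<epsilon> by (intro ge_one_powr_ge_zero) auto
    ultimately have "1 + ln (real n) \<le> (1 + 1 / \<epsilon>) * real n powr \<epsilon>" by (simp add: algebra_simps)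
    hence "\<bar>f n\<bar> \<le> K * ((1 + 1 / \<epsilon>) * real n powr \<epsilon>)"
      using assms(2)[of n] \<open>n \<ge> 1\<close> K by (meson mult_left_mono order.trans Suc_le_eq One_nat_def less_le_trans zero_less_one)
    hence "\<bar>f n\<bar> * real n powr - s \<le> K * ((1 + 1 / \<epsilon>) * real n powr \<epsilon>) * real n powr - s"
      by (intro mult_right_mono) auto
    also have "\<dots> = K * (1 + 1 / \<epsilon>) * real n powr (- s + \<epsilon>)" by (simp only: powr_add mult_ac)
    finally show "norm \<bar>if n > 0 then f n * real n powr - s else 0\<bar> \<le> K * (1 + 1 / \<epsilon>) * real n powr (- s + \<epsilon>)"
      using \<open>n \<ge> 1\<close> by (simp add: abs_mult)
  qed
  hence "(\<lambda>n. if n > 0 then f n * real n powr - s else 0) summable_on UNIV"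
    by (intro norm_summable_imp_summable_on) simp
  thus ?thesis by (subst (asm) summable_on_cong_neutral[where T = "{0<..}"]) (auto split: if_splits)
qed

text \<open>Bridges unordered sums and limits of ordered partial sums; the Abel estimates concern
  the latter.\<close>

lemma summable_on_pos_imp_tendsto:
  fixes f :: "nat \<Rightarrow> real"
  assumes "f summable_on {0<..}"
  shows "(\<lambda>n. \<Sum>k=1..<n. f k) \<longlonglongrightarrow> infsum f {0<..}"
proof -
  define g where "g = (\<lambda>n. if n > 0 then f n else 0)"
  have "(f has_sum infsum f {0<..}) {0<..}" using assms by simp
  hence "(g has_sum infsum f {0<..}) UNIV"
    by (subst has_sum_cong_neutral[where T = "{0<..}" and g = f]) (auto simp: g_def)
  hence "g sums infsum f {0<..}" by (rule has_sum_imp_sums)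
  hence "(\<lambda>n. \<Sum>k<n. g k) \<longlonglongrightarrow> infsum f {0<..}" by (simp add: sums_def)
  moreover have "(\<Sum>k<n. g k) = (\<Sum>k=1..<n. f k)" for n
    by (rule sum.mono_neutral_cong_right) (auto simp: g_def)
  ultimately show ?thesis by simp
qed

lemma sum_divisors_mult_coprime:
  fixes f :: "nat \<Rightarrow> real"
  assumes "coprime a b" "\<And>m n. f (m * n) = f m * f n"
  shows "(\<Sum>d | d dvd a * b. f d) = (\<Sum>d | d dvd a. f d) * (\<Sum>d | d dvd b. f d)"
proof -
  have gcd: "gcd (x * y) a = x" "gcd (x * y) b = y" if "x dvd a" "y dvd b" for x y
  proof -
    have "coprime a y" "coprime b x"
      using coprime_divisors[OF dvd_refl that(2) assms(1)] coprime_divisors[OF that(1) dvd_refl assms(1)]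
      by (simp_all add: coprime_commute)
    thus "gcd (x * y) a = x" "gcd (x * y) b = y"
      using that by (simp_all add: gcd_mult_left_right_cancel gcd_mult_left_left_cancel gcd_proj1_if_dvd_nat)
  qed
  have "bij_betw (\<lambda>(x, y). x * y) ({d. d dvd a} \<times> {d. d dvd b}) {d. d dvd a * b}"
  proof (rule bij_betwI[where g = "\<lambda>d. (gcd d a, gcd d b)"])
    fix d assume "d \<in> {d. d dvd a * b}"
    then obtain x y where "d = x * y" "x dvd a" "y dvd b" using division_decomp by blast
    thus "(\<lambda>(x, y). x * y) (gcd d a, gcd d b) = d" using gcd by simp
  qed (auto simp: gcd mult_dvd_mono)
  hence "(\<Sum>d | d dvd a * b. f d) = (\<Sum>(x, y)\<in>{d. d dvd a} \<times> {d. d dvd b}. f (x * y))"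
    by (subst sum.reindex_bij_betw[symmetric]) (auto simp: case_prod_unfold)
  also have "\<dots> = (\<Sum>d | d dvd a. f d) * (\<Sum>d | d dvd b. f d)"
    by (simp add: assms(2) sum_product sum.cartesian_product)
  finally show ?thesis .
qed

section \<open>Monotonicity of the weights in Monsky's Lambert series argument\<close>

lemma two_power_le:
  fixes x :: real
  assumes "0 < x" "x < 1" "p + q + 1 = 2 * n"
  shows "2 * x ^ n \<le> x ^ p + x ^ q"
proof -
  have *: "2 * x ^ n \<le> x ^ p + x ^ q" if "p < n" "p + q + 1 = 2 * n" for p q
  proof -
    define k where "k = n - p"
    have n: "n = p + k" "q + 1 = p + 2 * k" using that by (simp_all add: k_def)
    \<comment> \<open>Raising q by one makes n the mean of the two exponents, so the AM-GM
      inequality applies, with defect \<open>x ^ p * (1 - x ^ k)\<^sup>2\<close>.\<close>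
    have "x ^ (q + 1) \<le> x ^ q" using assms by (intro power_decreasing) auto
    moreover have e: "x ^ (q + 1) = x ^ p * (x ^ k * x ^ k)" "x ^ n = x ^ p * x ^ k"
      by (simp_all only: n mult_2 power_add)
    have "x ^ p + x ^ (q + 1) - 2 * x ^ n = x ^ p * (1 - x ^ k)\<^sup>2"
      unfolding e by (simp add: power2_eq_square algebra_simps)
    hence "x ^ p + x ^ (q + 1) - 2 * x ^ n \<ge> 0" using assms by simp
    ultimately show ?thesis by linarith
  qed
  have "p < n \<or> q < n" using assms(3) by arith
  thus ?thesis using *[of p q] *[of q p] assms(3) by (auto simp: add_ac)
qed

text \<open>Reversing both geometric sums replaces the exponent i + j by 2 n - 1 - i - j. Averaging
  the two expansions of the product termwise gives n (n + 1) terms, each at least x ^ n by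
  \<open>two_power_le\<close>.\<close>

lemma geometric_sums_product_ge:
  fixes x :: real
  assumes "0 < x" "x < 1"
  shows "real n * real (Suc n) * x ^ n \<le> (\<Sum>i<n. x ^ i) * (\<Sum>i<Suc n. x ^ i)"
proof -
  have rev: "(\<Sum>i<m. x ^ i) = (\<Sum>i<m. x ^ (m - Suc i))" for m
    by (rule sum.nat_diff_reindex[symmetric])
  have "2 * (real n * real (Suc n) * x ^ n) = (\<Sum>i<n. \<Sum>j<Suc n. 2 * x ^ n)" by simp
  also have "\<dots> \<le> (\<Sum>i<n. \<Sum>j<Suc n. x ^ (i + j) + x ^ ((n - Suc i) + (Suc n - Suc j)))"
    using assms by (intro sum_mono two_power_le) auto
  also have "\<dots> = (\<Sum>i<n. x ^ i) * (\<Sum>j<Suc n. x ^ j)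
      + (\<Sum>i<n. x ^ (n - Suc i)) * (\<Sum>j<Suc n. x ^ (Suc n - Suc j))"
    unfolding sum_product by (simp only: sum.distrib power_add)
  also have "\<dots> = 2 * ((\<Sum>i<n. x ^ i) * (\<Sum>i<Suc n. x ^ i))"
    unfolding rev[symmetric] by simp
  finally show ?thesis by simp
qed

text \<open>The weight of \<psi>(n) when the Lambert series is subtracted from L(1, \<psi>) / (1 -
  x). The two singular parts at x = 1 cancel, so the weights can be bounded independently of
  x.\<close>

definition lambert_coeff :: "real \<Rightarrow> nat \<Rightarrow> real" where
  "lambert_coeff x n = 1 / (real n * (1 - x)) - x ^ n / (1 - x ^ n)"

lemma lambert_coeff_eq:
  assumes "0 < x" "x < 1"
  shows "(1 - x) * lambert_coeff x n = 1 / real n - x ^ n / (\<Sum>i<n. x ^ i)"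
proof -
  have "1 - x ^ n = (\<Sum>i<n. x ^ i) * (1 - x)" by (simp add: one_diff_power_eq mult.commute)
  moreover have "(1 - x) * (u / (w * (1 - x))) = u / w" for u w
    using assms by (cases "w = 0") (simp_all add: divide_simps)
  ultimately show ?thesis
    by (simp only: lambert_coeff_def right_diff_distrib[of "1 - x" "_ / _"])
qed

text \<open>After multiplication by 1 - x, the drop from n to n + 1 is 1 / (n (n + 1)) - x ^ n / (A
  B), where A and B are the geometric sums of lengths n and n + 1. It is nonnegative by
  \<open>geometric_sums_product_ge\<close>.\<close>

lemma lambert_coeff_antimono:
  assumes x: "0 < x" "x < 1" and n: "n \<ge> 1"
  shows "lambert_coeff x (Suc n) \<le> lambert_coeff x n"
proof -
  define A where "A = (\<Sum>i<n. x ^ i)"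
  define B where "B = (\<Sum>i<Suc n. x ^ i)"
  have pos: "A > 0" "B > 0" using x n unfolding A_def B_def by (intro sum_pos; force simp: lessThan_empty_iff)+
  have B: "B = A + x ^ n" "B = 1 + x * A"
  proof -
    show "B = A + x ^ n" by (simp add: A_def B_def)
    show "B = 1 + x * A"
      unfolding A_def B_def by (subst sum.lessThan_Suc_shift) (simp add: sum_distrib_left)
  qed
  have "x ^ n / A - x ^ Suc n / B = x ^ n * (B - x * A) / (A * B)"
    using pos by (simp add: field_simps)
  also have "\<dots> = x ^ n / (A * B)" using B(2) by simp
  also have "\<dots> \<le> 1 / (real n * real (Suc n))"
    using geometric_sums_product_ge[OF x, of n] pos n unfolding A_def[symmetric] B_def[symmetric]
    by (simp add: divide_simps mult_ac)
  also have "\<dots> = 1 / real n - 1 / real (Suc n)" using n by (simp add: field_simps)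
  finally have "(1 - x) * lambert_coeff x (Suc n) \<le> (1 - x) * lambert_coeff x n"
    unfolding lambert_coeff_eq[OF x] A_def B_def by linarith
  thus ?thesis using x by simp
qed

lemma lambert_coeff_nonneg:
  assumes x: "0 < x" "x < 1" and n: "n \<ge> 1"
  shows "0 \<le> lambert_coeff x n"
proof -
  have "real n * x ^ n = (\<Sum>i<n. x ^ n)" by simp
  also have "\<dots> \<le> (\<Sum>i<n. x ^ i)" using x by (intro sum_mono power_decreasing) auto
  finally have "real n * x ^ n \<le> (\<Sum>i<n. x ^ i)" .
  moreover have "(\<Sum>i<n. x ^ i) > 0" using x n by (intro sum_pos) (force simp: lessThan_empty_iff)+
  ultimately have "x ^ n / (\<Sum>i<n. x ^ i) \<le> 1 / real n" using n by (simp add: field_simps)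
  hence "0 \<le> (1 - x) * lambert_coeff x n" unfolding lambert_coeff_eq[OF x] by simp
  thus ?thesis using x by (simp add: zero_le_mult_iff)
qed

lemma has_sum_geometric_pos:
  fixes y :: real
  assumes "0 \<le> y" "y < 1"
  shows "((\<lambda>m. y ^ m) has_sum (y / (1 - y))) {0<..}"
proof -
  have "(\<lambda>m. y * y ^ m) sums (y * (1 / (1 - y)))"
    using assms by (intro sums_mult geometric_sums) auto
  hence "((\<lambda>m. y * y ^ m) has_sum (y * (1 / (1 - y)))) UNIV"
    using assms by (intro norm_summable_imp_has_sum) (auto simp: sums_iff intro!: summable_mult summable_geometric)
  moreover have "bij_betw Suc UNIV {0<..}"
    by (rule bij_betwI[where g = "\<lambda>n. n - 1"]) auto
  ultimately show ?thesis using has_sum_reindex_bij_betw[of Suc UNIV "{0<..}" "\<lambda>m. y ^ m"] by simp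
qed

section \<open>Divisor sums of a real character\<close>

lemma split_off_prime_power:
  fixes n :: nat
  assumes "n > 1"
  obtains p k m where "prime p" "n = p ^ k * m" "coprime (p ^ k) m" "0 < m" "m < n"
proof -
  obtain p where p: "prime p" "p dvd n" using assms prime_factor_nat[of n] by auto
  define k where "k = multiplicity p n"
  obtain m where m: "n = p ^ k * m" "\<not> p dvd m"
    using multiplicity_decompose'[of n p] assms p unfolding k_def by (metis not_prime_unit not_one_less_zero)
  have "k > 0" using m p by (cases "k = 0") auto
  hence "p ^ k > 1" using p prime_gt_1_nat by (intro one_less_power) auto
  moreover have "m > 0" using m(1) assms by (cases "m = 0") auto
  ultimately have "m < n" unfolding m(1) by simp
  moreover have "coprime (p ^ k) m" using p(1) m(2) by (simp add: prime_imp_coprime)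
  ultimately show ?thesis using that p(1) m(1) \<open>m > 0\<close> by blast
qed

locale real_character =
  fixes \<psi> :: "nat \<Rightarrow> real"
  assumes mult: "\<psi> (m * n) = \<psi> m * \<psi> n"
    and one: "\<psi> 1 = 1" and zero: "\<psi> 0 = 0" and vals: "\<psi> n = 1 \<or> \<psi> n = 0 \<or> \<psi> n = -1"
begin

lemma abs_le_1: "\<bar>\<psi> n\<bar> \<le> 1"
  using vals[of n] by auto

lemma summable_on_L: "s > 1 \<Longrightarrow> (\<lambda>n. \<psi> n * real n powr - s) summable_on {0<..}"
proof (rule summable_on_ln_powr[where K = 1])
  fix n :: nat assume "n > 0"
  hence "0 \<le> ln (real n)" by simp
  thus "\<bar>\<psi> n\<bar> \<le> 1 * (1 + ln (real n))" using abs_le_1[of n] by simp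
qed

lemma power: "\<psi> (m ^ k) = \<psi> m ^ k"
  by (induction k) (simp_all add: mult one[unfolded One_nat_def])

lemma sum_divisors_prime_power:
  assumes "prime p"
  shows "0 \<le> (\<Sum>d | d dvd p ^ k. \<psi> d)" and "even k \<Longrightarrow> 1 \<le> (\<Sum>d | d dvd p ^ k. \<psi> d)"
proof -
  have "{d. d dvd p ^ k} = (\<lambda>i. p ^ i) ` {..k}"
    using assms by (auto simp: divides_primepow_nat)
  moreover have "inj_on (\<lambda>i. p ^ i) {..k}"
    using assms prime_gt_1_nat[of p] by (auto simp: inj_on_def)
  ultimately have eq: "(\<Sum>d | d dvd p ^ k. \<psi> d) = (\<Sum>i\<le>k. \<psi> p ^ i)"
    by (simp add: sum.reindex power)
  have "(\<Sum>i\<le>k. (-1::real) ^ i) = (if even k then 1 else 0)" by (induction k) auto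
  hence "0 \<le> (\<Sum>i\<le>k. \<psi> p ^ i) \<and> (even k \<longrightarrow> 1 \<le> (\<Sum>i\<le>k. \<psi> p ^ i))"
    using vals[of p] by (auto simp: power_0_left)
  thus "0 \<le> (\<Sum>d | d dvd p ^ k. \<psi> d)" and "even k \<Longrightarrow> 1 \<le> (\<Sum>d | d dvd p ^ k. \<psi> d)"
    unfolding eq by auto
qed

lemma sum_divisors_nonneg: "n > 0 \<Longrightarrow> 0 \<le> (\<Sum>d | d dvd n. \<psi> d)"
proof (induction n rule: less_induct)
  case (less n)
  show ?case
  proof (cases "n = 1")
    case False
    hence "n > 1" using less.prems by simp
    then obtain p k m where *: "prime p" "n = p ^ k * m" "coprime (p ^ k) m" "0 < m" "m < n"
      by (rule split_off_prime_power)
    have "(\<Sum>d | d dvd n. \<psi> d) = (\<Sum>d | d dvd p ^ k. \<psi> d) * (\<Sum>d | d dvd m. \<psi> d)"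
      unfolding *(2) using *(3) mult by (rule sum_divisors_mult_coprime)
    thus ?thesis using sum_divisors_prime_power(1)[OF *(1)] less.IH[OF *(5,4)] by simp
  qed (simp add: one[unfolded One_nat_def])
qed

text \<open>A square has only even exponents, for which the alternating sum 1 - 1 + ... + 1 is 1 and
  not 0. These coefficients make the Lambert series grow in Monsky's argument.\<close>

lemma sum_divisors_square_ge_1: "j > 0 \<Longrightarrow> 1 \<le> (\<Sum>d | d dvd j\<^sup>2. \<psi> d)"
proof (induction j rule: less_induct)
  case (less j)
  show ?case
  proof (cases "j = 1")
    case False
    hence "j > 1" using less.prems by simp
    then obtain p k m where *: "prime p" "j = p ^ k * m" "coprime (p ^ k) m" "0 < m" "m < j"
      by (rule split_off_prime_power)
    have j2: "j\<^sup>2 = p ^ (2 * k) * m\<^sup>2" unfolding *(2) by (simp add: power_mult_distrib power_mult power2_eq_square)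
    have "coprime ((p ^ k)\<^sup>2) (m\<^sup>2)" using *(3) by simp
    hence "coprime (p ^ (2 * k)) (m\<^sup>2)" by (simp add: mult.commute flip: power_mult)
    hence "(\<Sum>d | d dvd j\<^sup>2. \<psi> d) = (\<Sum>d | d dvd p ^ (2 * k). \<psi> d) * (\<Sum>d | d dvd m\<^sup>2. \<psi> d)"
      unfolding j2 using mult by (rule sum_divisors_mult_coprime)
    moreover have "1 \<le> (\<Sum>d | d dvd p ^ (2 * k). \<psi> d)" using *(1) by (rule sum_divisors_prime_power) simp
    ultimately show ?thesis using mult_mono[of 1 _ 1] less.IH[OF *(5,4)] by fastforce
  qed (simp add: one[unfolded One_nat_def])
qed

end

section \<open>Nonvanishing of L(1, \<psi>) for nonprincipal \<psi>\<close>

lemma infsum_minus_partial_sum_bound: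
  fixes f :: "nat \<Rightarrow> real"
  assumes "f summable_on {0<..}" "\<And>n. \<bar>\<Sum>k=m..<n. f k\<bar> \<le> B" "m \<ge> 1"
  shows "\<bar>infsum f {0<..} - (\<Sum>k=1..<m. f k)\<bar> \<le> B"
proof (rule tendsto_upperbound)
  show "(\<lambda>n. \<bar>(\<Sum>k=1..<n. f k) - (\<Sum>k=1..<m. f k)\<bar>) \<longlonglongrightarrow> \<bar>infsum f {0<..} - (\<Sum>k=1..<m. f k)\<bar>"
    using assms(1) by (intro tendsto_intros summable_on_pos_imp_tendsto)
  show "\<forall>\<^sub>F n in sequentially. \<bar>(\<Sum>k=1..<n. f k) - (\<Sum>k=1..<m. f k)\<bar> \<le> B"
    using eventually_ge_at_top[of m]
  proof eventually_elim
    case (elim n)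
    have "(\<Sum>k=1..<n. f k) = (\<Sum>k=1..<m. f k) + (\<Sum>k=m..<n. f k)"
      using assms(3) elim by (intro sum.atLeastLessThan_concat[symmetric])
    thus ?case using assms(2)[of n] by simp
  qed
qed simp

text \<open>Nonprincipality enters as boundedness of character sums, uniformly in both endpoints, so
  that \<open>abel_summation_bound\<close> can start anywhere.\<close>

locale nonprincipal_character = real_character +
  fixes C :: real
  assumes bounded: "\<And>m n. \<bar>\<Sum>k=m..<n. \<psi> k\<bar> \<le> C"
begin

lemma C_nonneg: "0 \<le> C"
  using bounded[of 0 0] by simp

text \<open>A limit of ordered partial sums, since the series at s = 1 need not converge absolutely
  and \<open>infsum\<close> would then default to 0.\<close>

definition L1 :: real where "L1 = lim (\<lambda>n. \<Sum>k=1..<n. \<psi> k / real k)"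

text \<open>Uniformity in s is the point: it lets L(s) be compared with L(1) through one common
  finite partial sum.\<close>

lemma partial_sum_powr_bound:
  assumes "s \<ge> 1" "m \<ge> 1"
  shows "\<bar>\<Sum>k=m..<n. \<psi> k * real k powr - s\<bar> \<le> C / real m"
proof -
  have "\<bar>\<Sum>k=m..<n. \<psi> k * real k powr - s\<bar> \<le> C * real m powr - s"
    using assms by (intro abel_summation_bound bounded powr_mono2') auto
  also have "real m powr - s \<le> real m powr - 1" using assms by (intro powr_mono) auto
  hence "C * real m powr - s \<le> C * real m powr - 1" using C_nonneg by (rule mult_left_mono)
  also have "\<dots> = C / real m" using assms by (simp add: powr_minus_divide)
  finally show ?thesis .
qed

lemma partial_sum_bound:
  assumes "m \<ge> 1"
  shows "\<bar>\<Sum>k=m..<n. \<psi> k / real k\<bar> \<le> C / real m"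
proof -
  have "(\<Sum>k=m..<n. \<psi> k / real k) = (\<Sum>k=m..<n. \<psi> k * real k powr - 1)"
    using assms by (intro sum.cong) (auto simp: powr_minus_divide)
  thus ?thesis using partial_sum_powr_bound[of 1 m n] assms by simp
qed

lemma tendsto_L1: "(\<lambda>n. \<Sum>k=1..<n. \<psi> k / real k) \<longlonglongrightarrow> L1"
proof -
  have "Cauchy (\<lambda>n. \<Sum>k=1..<n. \<psi> k / real k)"
  proof (rule CauchyI')
    fix e :: real assume "e > 0"
    obtain M :: nat where M: "real M > C / e" using reals_Archimedean2 by blast
    have "M > 0" using M C_nonneg \<open>e > 0\<close> by (cases "M = 0") (auto simp: divide_less_0_iff)
    show "\<exists>M. \<forall>m\<ge>M. \<forall>n>m. dist (\<Sum>k=1..<m. \<psi> k / real k) (\<Sum>k=1..<n. \<psi> k / real k) < e"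
    proof (intro exI allI impI)
      fix m n assume mn: "m \<ge> M" "n > m"
      have "(\<Sum>k=1..<n. \<psi> k / real k) = (\<Sum>k=1..<m. \<psi> k / real k) + (\<Sum>k=m..<n. \<psi> k / real k)"
        using mn \<open>M > 0\<close> by (intro sum.atLeastLessThan_concat[symmetric]) auto
      hence "dist (\<Sum>k=1..<m. \<psi> k / real k) (\<Sum>k=1..<n. \<psi> k / real k) = \<bar>\<Sum>k=m..<n. \<psi> k / real k\<bar>"
        by (simp add: dist_real_def)
      also have "\<dots> \<le> C / real m" using mn \<open>M > 0\<close> by (intro partial_sum_bound) auto
      also have "\<dots> \<le> C / real M" using mn \<open>M > 0\<close> C_nonneg by (intro divide_left_mono) auto
      also have "\<dots> < e" using M \<open>e > 0\<close> \<open>M > 0\<close> by (simp add: field_simps)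
      finally show "dist (\<Sum>k=1..<m. \<psi> k / real k) (\<Sum>k=1..<n. \<psi> k / real k) < e" .
    qed
  qed
  thus ?thesis unfolding L1_def by (simp add: Cauchy_convergent_iff convergent_LIMSEQ_iff)
qed

text \<open>Expand each quotient as a geometric series and collect the powers x ^ (d m) by n = d m.
  Absolute convergence rests on 1 - x ^ d being at least 1 - x.\<close>

lemma lambert_series:
  assumes x: "0 < x" "x < 1"
  shows "(\<lambda>n. \<psi> n * (x ^ n / (1 - x ^ n))) summable_on {0<..}"
    and "(\<lambda>n. (\<Sum>d | d dvd n. \<psi> d) * x ^ n) summable_on {0<..}"
    and "infsum (\<lambda>n. \<psi> n * (x ^ n / (1 - x ^ n))) {0<..} = infsum (\<lambda>n. (\<Sum>d | d dvd n. \<psi> d) * x ^ n) {0<..}"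
proof -
  define g where "g = (\<lambda>(d, m). \<psi> d * (x ^ d) ^ m)"
  have pow: "x ^ d < 1" "0 \<le> x ^ d" if "d > 0" for d
    using x that by (auto intro: power_Suc_less_one simp: power_less_one_iff)
  have geo: "((\<lambda>m. (x ^ d) ^ m) has_sum (x ^ d / (1 - x ^ d))) {0<..}" if "d \<in> {0<..}" for d
    using pow[of d] that by (intro has_sum_geometric_pos) auto
  have sx: "(\<lambda>d. x ^ d) summable_on {0<..}"
    using has_sum_geometric_pos[of x] x by (auto simp: summable_on_def)
  have "(\<lambda>d. \<bar>\<psi> d\<bar> * (x ^ d / (1 - x ^ d))) summable_on {0<..}"
  proof (rule summable_on_comparison_test)
    show "(\<lambda>d. x ^ d * (1 / (1 - x))) summable_on {0<..}" using sx by (rule summable_on_cmult_left)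
    fix d :: nat assume d: "d \<in> {0<..}"
    have "x ^ d \<le> x ^ 1" using d x by (intro power_decreasing) auto
    hence "x ^ d / (1 - x ^ d) \<le> x ^ d / (1 - x)" using x pow[of d] d by (intro divide_left_mono) auto
    moreover have "\<bar>\<psi> d\<bar> * (x ^ d / (1 - x ^ d)) \<le> 1 * (x ^ d / (1 - x ^ d))"
      using abs_le_1[of d] pow[of d] d by (intro mult_right_mono) auto
    ultimately show "\<bar>\<psi> d\<bar> * (x ^ d / (1 - x ^ d)) \<le> x ^ d * (1 / (1 - x))" by simp
    show "0 \<le> \<bar>\<psi> d\<bar> * (x ^ d / (1 - x ^ d))" using pow[of d] d by simp
  qed
  moreover have "infsum (\<lambda>m. norm (g (d, m))) {0<..} = \<bar>\<psi> d\<bar> * (x ^ d / (1 - x ^ d))" if "d \<in> {0<..}" for d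
    using infsumI[OF geo[OF that]] x by (simp add: g_def abs_mult infsum_cmult_right')
  ultimately have "(\<lambda>d. infsum (\<lambda>m. norm (g (d, m))) {0<..}) summable_on {0<..}"
    by (subst summable_on_cong) auto
  moreover have "infsum (\<lambda>m. norm (g (d, m))) {0<..} \<ge> 0" for d by (intro infsum_nonneg) auto
  moreover have "(\<lambda>m. norm (g (d, m))) summable_on {0<..}" if "d \<in> {0<..}" for d
  proof -
    have "(\<lambda>m. (x ^ d) ^ m) summable_on {0<..}" using geo[OF that] by (rule has_sum_imp_summable)
    hence "(\<lambda>m. \<bar>\<psi> d\<bar> * (x ^ d) ^ m) summable_on {0<..}" by (rule summable_on_cmult_right)
    thus ?thesis using x by (simp add: g_def abs_mult)
  qed
  ultimately have "(\<lambda>y. norm (g y)) summable_on ({0<..} \<times> {0<..})"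
    using abs_summable_on_Sigma_iff[of g "{0<..}" "\<lambda>_. {0<..}"] by simp
  hence gs: "g summable_on ({0<..} \<times> {0<..})" by (rule abs_summable_summable)
  have inner: "infsum (\<lambda>m. g (d, m)) {0<..} = \<psi> d * (x ^ d / (1 - x ^ d))" if "d \<in> {0<..}" for d
    using infsumI[OF geo[OF that]] by (simp add: g_def infsum_cmult_right')
  have conv: "(\<Sum>d | d dvd n. g (d, n div d)) = (\<Sum>d | d dvd n. \<psi> d) * x ^ n" for n
    unfolding sum_distrib_right by (intro sum.cong) (auto simp: g_def simp flip: power_mult)
  show "(\<lambda>n. (\<Sum>d | d dvd n. \<psi> d) * x ^ n) summable_on {0<..}"
    using infsum_divisor_pairs(1)[OF gs] by (simp add: conv)
  have gs': "(\<lambda>(x, y). g (x, y)) summable_on ({0<..} \<times> {0<..})" using gs by simp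
  show "(\<lambda>n. \<psi> n * (x ^ n / (1 - x ^ n))) summable_on {0<..}"
    using summable_on_Sigma_banach[OF gs']
    by (rule summable_on_cong[THEN iffD1, rotated]) (rule inner)
  have "infsum (\<lambda>n. \<psi> n * (x ^ n / (1 - x ^ n))) {0<..} = infsum (\<lambda>d. infsum (\<lambda>m. g (d, m)) {0<..}) {0<..}"
    by (intro infsum_cong) (simp add: inner)
  also have "\<dots> = infsum g ({0<..} \<times> {0<..})" using infsum_Sigma'_banach[OF gs'] by simp
  also have "\<dots> = infsum (\<lambda>n. (\<Sum>d | d dvd n. \<psi> d) * x ^ n) {0<..}"
    using infsum_divisor_pairs(2)[OF gs] by (simp add: conv)
  finally show "infsum (\<lambda>n. \<psi> n * (x ^ n / (1 - x ^ n))) {0<..} = infsum (\<lambda>n. (\<Sum>d | d dvd n. \<psi> d) * x ^ n) {0<..}" .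
qed

text \<open>Keep only the terms at squares of j \<le> M, whose coefficients are at least 1, and
  replace each power by the smallest of them.\<close>

lemma lambert_series_ge:
  assumes x: "0 < x" "x < 1"
  shows "real M * x ^ M\<^sup>2 \<le> infsum (\<lambda>n. (\<Sum>d | d dvd n. \<psi> d) * x ^ n) {0<..}"
proof -
  define F where "F = (\<lambda>j::nat. j\<^sup>2) ` {1..M}"
  have inj: "inj_on (\<lambda>j::nat. j\<^sup>2) {1..M}" by (auto simp: inj_on_def power2_eq_iff)
  have "real M * x ^ M\<^sup>2 = (\<Sum>j=1..M. x ^ M\<^sup>2)" by simp
  also have "\<dots> \<le> (\<Sum>j=1..M. (\<Sum>d | d dvd j\<^sup>2. \<psi> d) * x ^ j\<^sup>2)"
  proof (rule sum_mono)
    fix j assume j: "j \<in> {1..M}"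
    hence "x ^ M\<^sup>2 \<le> x ^ j\<^sup>2" using x by (intro power_decreasing power_mono) auto
    also have "\<dots> \<le> (\<Sum>d | d dvd j\<^sup>2. \<psi> d) * x ^ j\<^sup>2"
      using mult_right_mono[OF sum_divisors_square_ge_1[of j], of "x ^ j\<^sup>2"] j x by simp
    finally show "x ^ M\<^sup>2 \<le> (\<Sum>d | d dvd j\<^sup>2. \<psi> d) * x ^ j\<^sup>2" .
  qed
  also have "\<dots> = (\<Sum>n\<in>F. (\<Sum>d | d dvd n. \<psi> d) * x ^ n)"
    unfolding F_def by (subst sum.reindex[OF inj]) simp
  also have "\<dots> \<le> infsum (\<lambda>n. (\<Sum>d | d dvd n. \<psi> d) * x ^ n) {0<..}"
    using x sum_divisors_nonneg by (intro finite_sum_le_infsum lambert_series) (auto simp: F_def)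
  finally show ?thesis .
qed

text \<open>Monsky's argument: if \<open>L1\<close> vanished, then the Lambert series of \<open>\<psi>\<close> would stay bounded
  as \<open>x \<rightarrow> 1\<close>, since it differs from a multiple of \<open>L1\<close> by a series with decreasing weights.\<close>

lemma L1_nonzero: "L1 \<noteq> 0"
proof
  assume L1: "L1 = 0"
  have bound: "infsum (\<lambda>n. \<psi> n * (x ^ n / (1 - x ^ n))) {0<..} \<le> C" if x: "0 < x" "x < 1" for x
  proof -
    have "(\<lambda>n. (\<Sum>k=1..<n. \<psi> k / real k) / (1 - x) - (\<Sum>k=1..<n. \<psi> k * (x ^ k / (1 - x ^ k))))
        \<longlonglongrightarrow> L1 / (1 - x) - infsum (\<lambda>n. \<psi> n * (x ^ n / (1 - x ^ n))) {0<..}"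
      using x by (intro tendsto_intros tendsto_L1 summable_on_pos_imp_tendsto lambert_series) auto
    moreover have "(\<Sum>k=1..<n. \<psi> k / real k) / (1 - x) - (\<Sum>k=1..<n. \<psi> k * (x ^ k / (1 - x ^ k)))
        = (\<Sum>k=1..<n. \<psi> k * lambert_coeff x k)" for n
      unfolding lambert_coeff_def sum_divide_distrib sum_subtractf[symmetric]
      by (intro sum.cong) (simp_all add: right_diff_distrib)
    ultimately have "(\<lambda>n. \<Sum>k=1..<n. \<psi> k * lambert_coeff x k)
        \<longlonglongrightarrow> - infsum (\<lambda>n. \<psi> n * (x ^ n / (1 - x ^ n))) {0<..}"
      using L1 by simp
    moreover have "- C \<le> (\<Sum>k=1..<n. \<psi> k * lambert_coeff x k)" for n
    proof -
      \<comment> \<open>As the weights start at 1, the Abel bound is C, the same for all x.\<close>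
      have "lambert_coeff x 1 = 1" using x by (simp add: lambert_coeff_def field_simps)
      hence "\<bar>\<Sum>k=1..<n. \<psi> k * lambert_coeff x k\<bar> \<le> C"
        using abel_summation_bound[of \<psi> 1 C "lambert_coeff x" n] bounded
          lambert_coeff_antimono[OF x] lambert_coeff_nonneg[OF x] by simp
      thus ?thesis by linarith
    qed
    ultimately have "- C \<le> - infsum (\<lambda>n. \<psi> n * (x ^ n / (1 - x ^ n))) {0<..}"
      by (intro tendsto_lowerbound[where F = sequentially]) auto
    thus ?thesis by simp
  qed
  \<comment> \<open>With x = 1 - 1 / (2 M^2), Bernoulli's inequality keeps x ^ (M^2) at least 1/2,
    so the series is at least M / 2 > C.\<close>
  obtain M :: nat where M: "real M > 2 * C" using reals_Archimedean2 by blast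
  have "M > 0" using M C_nonneg by (cases "M = 0") auto
  define y where "y = real (M\<^sup>2)"
  define x where "x = 1 - 1 / (2 * y)"
  have y: "y \<ge> 1" using \<open>M > 0\<close> by (simp add: y_def Suc_le_eq)
  have x: "0 < x" "x < 1" using y by (simp_all add: x_def field_simps)
  have "1 + y * (x - 1) \<le> (1 + (x - 1)) ^ (M\<^sup>2)"
    unfolding y_def using x by (intro Bernoulli_inequality) simp
  moreover have "1 + y * (x - 1) = 1 / 2" using y by (simp add: x_def)
  ultimately have "1 / 2 \<le> x ^ M\<^sup>2" by simp
  hence "real M * (1 / 2) \<le> real M * x ^ M\<^sup>2" by (intro mult_left_mono) auto
  also have "\<dots> \<le> C" using lambert_series_ge[OF x, of M] bound[OF x] lambert_series(3)[OF x] by simp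
  finally show False using M by simp
qed

lemma L_bounded_below:
  obtains c where "c > 0" "\<forall>\<^sub>F s in at_right 1. c \<le> \<bar>infsum (\<lambda>n. \<psi> n * real n powr - s) {0<..}\<bar>"
proof -
  \<comment> \<open>A budget of four: the tail at 1, the tail at s and the change of the finite sum
    cost at most c each, which leaves c.\<close>
  define c where "c = \<bar>L1\<bar> / 4"
  have c: "c > 0" using L1_nonzero by (simp add: c_def)
  obtain m :: nat where m: "real m > C / c" using reals_Archimedean2 by blast
  have "m > 0" using m C_nonneg c by (cases "m = 0") (auto simp: divide_less_0_iff)
  have Cm: "C / real m \<le> c" using m c \<open>m > 0\<close> by (simp add: field_simps)
  have "\<bar>L1 - (\<Sum>k=1..<m. \<psi> k / real k)\<bar> \<le> C / real m"
  proof (rule tendsto_upperbound)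
    show "(\<lambda>n. \<bar>(\<Sum>k=1..<n. \<psi> k / real k) - (\<Sum>k=1..<m. \<psi> k / real k)\<bar>) \<longlonglongrightarrow> \<bar>L1 - (\<Sum>k=1..<m. \<psi> k / real k)\<bar>"
      by (intro tendsto_intros tendsto_L1)
    show "\<forall>\<^sub>F n in sequentially. \<bar>(\<Sum>k=1..<n. \<psi> k / real k) - (\<Sum>k=1..<m. \<psi> k / real k)\<bar> \<le> C / real m"
      using eventually_ge_at_top[of m]
    proof eventually_elim
      case (elim n)
      have "(\<Sum>k=1..<n. \<psi> k / real k) = (\<Sum>k=1..<m. \<psi> k / real k) + (\<Sum>k=m..<n. \<psi> k / real k)"
        using \<open>m > 0\<close> elim by (intro sum.atLeastLessThan_concat[symmetric]) auto
      thus ?case using partial_sum_bound[of m n] \<open>m > 0\<close> by simp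
    qed
  qed simp
  hence 1: "\<bar>\<Sum>k=1..<m. \<psi> k / real k\<bar> \<ge> 3 * c" using Cm c_def by linarith
  have "((\<lambda>s. \<Sum>k=1..<m. \<psi> k * real k powr - s) \<longlongrightarrow> (\<Sum>k=1..<m. \<psi> k * real k powr - 1)) (at_right 1)"
    by (intro tendsto_intros) auto
  moreover have "(\<Sum>k=1..<m. \<psi> k * real k powr - 1) = (\<Sum>k=1..<m. \<psi> k / real k)"
    by (intro sum.cong) (auto simp: powr_minus_divide)
  ultimately have lim: "((\<lambda>s. \<Sum>k=1..<m. \<psi> k * real k powr - s) \<longlongrightarrow> (\<Sum>k=1..<m. \<psi> k / real k)) (at_right 1)"
    by (simp only:)
  have "\<forall>\<^sub>F s in at_right 1. dist (\<Sum>k=1..<m. \<psi> k * real k powr - s) (\<Sum>k=1..<m. \<psi> k / real k) < c"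
    using lim c by (rule tendstoD)
  hence "\<forall>\<^sub>F s in at_right 1. c \<le> \<bar>infsum (\<lambda>n. \<psi> n * real n powr - s) {0<..}\<bar>"
    using eventually_at_right_less[of 1]
  proof eventually_elim
    case (elim s)
    have "\<bar>infsum (\<lambda>n. \<psi> n * real n powr - s) {0<..} - (\<Sum>k=1..<m. \<psi> k * real k powr - s)\<bar> \<le> C / real m"
      using elim \<open>m > 0\<close> by (intro infsum_minus_partial_sum_bound summable_on_L partial_sum_powr_bound) auto
    thus ?case using elim 1 Cm unfolding dist_real_def by linarith
  qed
  thus ?thesis using that c by blast
qed

end

section \<open>The logarithmic derivative as s tends to 1 from the right\<close>

lemma mangoldt_le_ln:
  assumes "n > 0"
  shows "(mangoldt n :: real) \<le> ln n"
proof -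
  have "(mangoldt n :: real) \<le> (\<Sum>d | d dvd n. mangoldt d)"
    using assms by (intro member_le_sum) (auto simp: mangoldt_nonneg)
  thus ?thesis using mangoldt_sum[of n, where 'a = real] assms by simp
qed

context real_character
begin

lemma summable_on_L_ln: "s > 1 \<Longrightarrow> (\<lambda>n. \<psi> n * ln n * real n powr - s) summable_on {0<..}"
proof (rule summable_on_ln_powr[where K = 1])
  fix n :: nat assume "n > 0"
  hence "0 \<le> ln (real n)" by simp
  moreover from this have "\<bar>\<psi> n\<bar> * ln (real n) \<le> 1 * ln (real n)"
    using abs_le_1[of n] by (intro mult_right_mono)
  ultimately show "\<bar>\<psi> n * ln (real n)\<bar> \<le> 1 * (1 + ln (real n))" by (simp add: abs_mult)
qed

lemma summable_on_L_mangoldt: "s > 1 \<Longrightarrow> (\<lambda>n. \<psi> n * mangoldt n * real n powr - s) summable_on {0<..}"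
proof (rule summable_on_ln_powr[where K = 1])
  fix n :: nat assume n: "n > 0"
  have "\<bar>\<psi> n\<bar> * mangoldt n \<le> 1 * ln (real n)"
    using abs_le_1[of n] mangoldt_le_ln[OF n] by (intro mult_mono) (auto simp: mangoldt_nonneg)
  thus "\<bar>\<psi> n * mangoldt n\<bar> \<le> 1 * (1 + ln (real n))" by (simp add: abs_mult)
qed

definition L :: "real \<Rightarrow> real" where
  "L s = infsum (\<lambda>n. \<psi> n * real n powr - s) {0<..}"

definition F :: "real \<Rightarrow> real" where
  "F s = infsum (\<lambda>n. \<psi> n * mangoldt n * real n powr - s) {0<..}"

text \<open>\<open>F\<close> is \<open>- L' / L\<close>, and the left-hand side is \<open>- L'\<close>.\<close>

lemma infsum_ln_eq:
  assumes s: "s > 1"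
  shows "infsum (\<lambda>n. \<psi> n * ln n * real n powr - s) {0<..} = L s * F s"
proof -
  define g where "g = (\<lambda>(d, m). (\<psi> d * mangoldt d * real d powr - s) * (\<psi> m * real m powr - s))"
  have g: "g summable_on {0<..} \<times> {0<..}" "infsum g ({0<..} \<times> {0<..}) = F s * L s"
    using infsum_mult_times[OF summable_on_L_mangoldt[OF s] summable_on_L[OF s]]
    unfolding g_def F_def L_def by auto
  have "(\<Sum>d | d dvd n. g (d, n div d)) = \<psi> n * ln n * real n powr - s" if n: "n \<in> {0<..}" for n
  proof -
    \<comment> \<open>Complete multiplicativity pulls the factor depending on n out of the divisor
      sum; what remains is the sum of the Mangoldt function over divisors, which is ln n.\<close>
    have "(\<Sum>d | d dvd n. g (d, n div d)) = (\<Sum>d | d dvd n. mangoldt d * (\<psi> n * real n powr - s))"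
    proof (rule sum.cong[OF refl])
      fix d assume "d \<in> {d. d dvd n}"
      then obtain m where m: "n = d * m" by blast
      hence "d > 0" "m > 0" using n by auto
      thus "g (d, n div d) = mangoldt d * (\<psi> n * real n powr - s)"
        by (simp add: g_def m mult powr_mult)
    qed
    also have "\<dots> = \<psi> n * ln n * real n powr - s"
      unfolding sum_distrib_right[symmetric] using n by (simp add: mangoldt_sum)
    finally show ?thesis .
  qed
  hence "infsum (\<lambda>n. \<psi> n * ln n * real n powr - s) {0<..} = infsum (\<lambda>n. \<Sum>d | d dvd n. g (d, n div d)) {0<..}"
    by (intro infsum_cong) simp
  thus ?thesis using infsum_divisor_pairs(2)[OF g(1)] g(2) by (simp add: mult.commute)
qed

end

text \<open>The function ln x / x^s peaks at e^(1/s) \<le> e, hence the threshold 3. The discrete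
  proof settles s = 1 with ln k \<ge> 1 and ln (1 + 1/k) \<le> 1/k; larger s only shrinks the ratio
  of the powers.\<close>

lemma ln_powr_antimono:
  fixes s :: real
  assumes "s \<ge> 1" "k \<ge> 3"
  shows "ln (real (Suc k)) * real (Suc k) powr - s \<le> ln (real k) * real k powr - s"
proof -
  have k: "real k \<ge> 3" using assms by simp
  have "exp 1 \<le> real k" using exp_le k by linarith
  hence "1 \<le> ln (real k)" using k by (subst ln_ge_iff) auto
  have "real (Suc k) = real k * (1 + 1 / real k)" using k by (simp add: distrib_left)
  hence "ln (real (Suc k)) = ln (real k * (1 + 1 / real k))" by (simp only:)
  also have "\<dots> = ln (real k) + ln (1 + 1 / real k)" using k by (intro ln_mult_pos) (auto intro: add_pos_pos)
  also have "\<dots> \<le> ln (real k) + 1 / real k" using k by (intro add_left_mono ln_add_one_self_le_self) auto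
  finally have "real k * ln (real (Suc k)) \<le> real k * ln (real k) + 1" using k by (simp add: field_simps)
  also have "\<dots> \<le> real (Suc k) * ln (real k)" using \<open>1 \<le> ln (real k)\<close> by (simp add: algebra_simps)
  finally have 1: "ln (real (Suc k)) * (real k / real (Suc k)) \<le> ln (real k)" using k by (simp add: field_simps)
  have "(real k / real (Suc k)) powr s \<le> (real k / real (Suc k)) powr 1"
    using assms k by (intro powr_mono') auto
  hence "(real k / real (Suc k)) powr s \<le> real k / real (Suc k)" using k by simp
  hence "ln (real (Suc k)) * (real k / real (Suc k)) powr s \<le> ln (real (Suc k)) * (real k / real (Suc k))"
    by (intro mult_left_mono) auto
  hence "ln (real (Suc k)) * (real k / real (Suc k)) powr s \<le> ln (real k)" using 1 by linarith
  hence "ln (real (Suc k)) * (real k / real (Suc k)) powr s * real k powr - s \<le> ln (real k) * real k powr - s"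
    by (intro mult_right_mono) auto
  moreover have "(real k / real (Suc k)) powr s * real k powr - s = real (Suc k) powr - s"
    using k by (simp add: powr_divide powr_minus field_simps)
  ultimately show ?thesis by (simp only: mult.assoc)
qed

context nonprincipal_character
begin

text \<open>The terms before the monotone range are bounded by hand: k = 1 gives 0 and k = 2 at most
  ln 2.\<close>

lemma infsum_ln_bound:
  assumes s: "s > 1"
  shows "\<bar>infsum (\<lambda>n. \<psi> n * ln n * real n powr - s) {0<..}\<bar> \<le> C * ln 3 + ln 2"
proof -
  have "\<bar>infsum (\<lambda>n. \<psi> n * ln n * real n powr - s) {0<..} - (\<Sum>k=1..<3. \<psi> k * ln k * real k powr - s)\<bar> \<le> C * ln 3"
  proof (rule infsum_minus_partial_sum_bound[OF summable_on_L_ln[OF s]])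
    fix n
    have "\<bar>\<Sum>k=3..<n. \<psi> k * (ln (real k) * real k powr - s)\<bar> \<le> C * (ln (real 3) * real 3 powr - s)"
      using s by (intro abel_summation_bound bounded ln_powr_antimono) auto
    also have "\<dots> \<le> C * (ln (real 3) * 1)"
    proof -
      have "(3::real) powr - s \<le> 3 powr 0" using s by (intro powr_mono) auto
      thus ?thesis using C_nonneg by (intro mult_left_mono) auto
    qed
    finally show "\<bar>\<Sum>k=3..<n. \<psi> k * ln (real k) * real k powr - s\<bar> \<le> C * ln 3" by (simp add: mult.assoc)
  qed simp
  moreover have "(\<Sum>k=1..<3. \<psi> k * ln k * real k powr - s) = \<psi> 2 * ln 2 * 2 powr - s"
    by (simp add: numeral_3_eq_3 numeral_2_eq_2)
  moreover have "\<bar>\<psi> 2 * ln 2 * 2 powr - s\<bar> \<le> ln 2"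
  proof -
    have "(2::real) powr - s \<le> 2 powr 0" using s by (intro powr_mono) auto
    hence "\<bar>\<psi> 2\<bar> * ln 2 * 2 powr - s \<le> 1 * ln 2 * 1" using abs_le_1[of 2] by (intro mult_mono) auto
    thus ?thesis by (simp add: abs_mult)
  qed
  ultimately show ?thesis by linarith
qed

lemma F_bounded: "\<exists>B. \<forall>\<^sub>F s in at_right 1. \<bar>F s\<bar> \<le> B"
proof -
  obtain c where c: "c > 0" "\<forall>\<^sub>F s in at_right 1. c \<le> \<bar>L s\<bar>"
    using L_bounded_below unfolding L_def by blast
  define D where "D = C * ln 3 + ln 2"
  have "\<forall>\<^sub>F s in at_right 1. \<bar>F s\<bar> \<le> D / c"
    using c(2) eventually_at_right_less[of 1]
  proof eventually_elim
    case (elim s)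
    have "c * \<bar>F s\<bar> \<le> \<bar>L s\<bar> * \<bar>F s\<bar>" using elim by (intro mult_right_mono) auto
    also have "\<dots> \<le> D" using infsum_ln_bound[of s] infsum_ln_eq[of s] elim by (simp add: D_def abs_mult)
    finally show ?case using c(1) by (simp add: field_simps)
  qed
  thus ?thesis ..
qed

end

text \<open>Nonnegativity and the values on one progression already make the series diverge at
  1.\<close>

locale principal_character = real_character +
  fixes K :: nat
  assumes nonneg: "\<psi> n \<ge> 0" and K_pos: "K > 0" and progression: "\<psi> (K * j + 1) = 1"
begin

lemma L_at_top: "\<forall>\<^sub>F s in at_right 1. T \<le> L s"
proof -
  \<comment> \<open>Since K j + 1 \<le> (K + 1) j, the progression is compared with the harmonic
    sum. This J makes the finite sum at s = 1 at least T + 1, and the spare 1 pays for moving to s >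
    1.\<close>
  obtain J :: nat where J: "real J \<ge> exp (real (K + 1) * (T + 1))" using real_arch_simple by blast
  have Kp: "real (K + 1) > 0" by simp
  define g where "g = (\<lambda>j. K * j + 1)"
  have gpos: "real (g j) > 0" for j by (simp add: g_def add_pos_nonneg)
  have inj: "inj_on g {1..J}" using K_pos by (auto simp: inj_on_def g_def)
  have "ln (exp (real (K + 1) * (T + 1))) \<le> ln (real J + 1)" using J by (subst ln_le_cancel_iff) auto
  hence "real (K + 1) * (T + 1) \<le> harm J" using ln_le_harm[of J] by simp
  also have "harm J \<le> (\<Sum>j=1..J. real (K + 1) * (1 / real (g j)))"
    unfolding harm_def
  proof (rule sum_mono)
    fix j assume j: "j \<in> {1..J}"
    have "real (g j) \<le> real (K + 1) * real j" using j by (simp add: g_def algebra_simps)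
    thus "inverse (of_nat j) \<le> real (K + 1) * (1 / real (g j))" using j gpos[of j] by (simp add: field_simps)
  qed
  also have "\<dots> = real (K + 1) * (\<Sum>j=1..J. 1 / real (g j))" by (simp add: sum_distrib_left)
  finally have T: "T + 1 \<le> (\<Sum>j=1..J. 1 / real (g j))" using Kp by (simp only: mult_le_cancel_left_pos)
  have "((\<lambda>s. \<Sum>j=1..J. real (g j) powr - s) \<longlongrightarrow> (\<Sum>j=1..J. real (g j) powr - 1)) (at_right 1)"
    using gpos by (intro tendsto_intros) (metis less_irrefl)
  moreover have "(\<Sum>j=1..J. real (g j) powr - 1) = (\<Sum>j=1..J. 1 / real (g j))"
    by (intro sum.cong) (auto simp: powr_minus_divide g_def)
  ultimately have lim: "((\<lambda>s. \<Sum>j=1..J. real (g j) powr - s) \<longlongrightarrow> (\<Sum>j=1..J. 1 / real (g j))) (at_right 1)"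
    by (simp only:)
  have "\<forall>\<^sub>F s in at_right 1. dist (\<Sum>j=1..J. real (g j) powr - s) (\<Sum>j=1..J. 1 / real (g j)) < 1"
    using lim by (rule tendstoD) simp
  thus ?thesis using eventually_at_right_less[of 1]
  proof eventually_elim
    case (elim s)
    have "(\<Sum>j=1..J. real (g j) powr - s) = (\<Sum>n\<in>g ` {1..J}. \<psi> n * real n powr - s)"
      by (subst sum.reindex[OF inj]) (simp add: g_def progression[simplified])
    also have "\<dots> \<le> L s"
      unfolding L_def using elim nonneg by (intro finite_sum_le_infsum summable_on_L) (auto simp: g_def)
    finally show ?case using elim T unfolding dist_real_def by linarith
  qed
qed

text \<open>If F \<le> B, then -L' = L F \<le> B L. But the terms of -L' with k \<ge> M carry a
  factor ln k \<ge> B + 1, so -L' is at least (ln M) L - M ln M. Together these force L \<le> M ln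
  M, against \<open>L_at_top\<close>.\<close>

lemma F_unbounded: "\<not> (\<forall>\<^sub>F s in at_right 1. F s \<le> B)"
proof
  assume FB: "\<forall>\<^sub>F s in at_right 1. F s \<le> B"
  obtain M0 :: nat where M0: "real M0 \<ge> exp (B + 1)" using real_arch_simple by blast
  define M where "M = max M0 1"
  have M: "real M \<ge> exp (B + 1)" "M \<ge> 1" using M0 by (auto simp: M_def)
  have lnM: "ln (real M) \<ge> B + 1" using M by (subst ln_ge_iff) auto
  have lnM0: "ln (real M) \<ge> 0" using M by simp
  have "\<forall>\<^sub>F s::real in at_right 1. False"
    using FB L_at_top[of "real M * ln (real M) + 1"] eventually_at_right_less[of 1]
  proof eventually_elim
    case (elim s)
    have "ln (real M) * L s \<le> L s * F s + real M * ln (real M)"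
    proof (rule LIMSEQ_le)
      show "(\<lambda>n. ln (real M) * (\<Sum>k=1..<n. \<psi> k * real k powr - s)) \<longlonglongrightarrow> ln (real M) * L s"
        unfolding L_def using elim by (intro tendsto_intros summable_on_pos_imp_tendsto summable_on_L)
      show "(\<lambda>n. (\<Sum>k=1..<n. \<psi> k * ln k * real k powr - s) + real M * ln (real M)) \<longlonglongrightarrow> L s * F s + real M * ln (real M)"
        using summable_on_pos_imp_tendsto[OF summable_on_L_ln[of s]] infsum_ln_eq[of s] elim
        by (intro tendsto_add tendsto_const) simp
      have "ln (real M) * (\<Sum>k=1..<n. \<psi> k * real k powr - s)
          \<le> (\<Sum>k=1..<n. \<psi> k * ln k * real k powr - s) + real M * ln (real M)" for n
      proof -
        have 1: "ln (real M) * (\<Sum>k=1..<n. \<psi> k * real k powr - s)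
            \<le> (\<Sum>k=1..<n. \<psi> k * ln k * real k powr - s + (if k < M then ln (real M) else 0))"
          unfolding sum_distrib_left
        proof (rule sum_mono)
          fix k assume k: "k \<in> {1..<n}"
          have u: "0 \<le> \<psi> k * real k powr - s" using nonneg by simp
          show "ln (real M) * (\<psi> k * real k powr - s)
              \<le> \<psi> k * ln k * real k powr - s + (if k < M then ln (real M) else 0)"
          proof (cases "k < M")
            case True
            have "real k powr - s \<le> real k powr 0" using k elim by (intro powr_mono) auto
            hence "\<psi> k * real k powr - s \<le> 1 * 1" using k abs_le_1[of k] nonneg[of k] by (intro mult_mono) auto
            hence "ln (real M) * (\<psi> k * real k powr - s) \<le> ln (real M) * 1" using lnM0 by (intro mult_left_mono) auto
            moreover have "0 \<le> \<psi> k * ln k * real k powr - s" using k nonneg[of k] by simp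
            ultimately show ?thesis using True by simp
          next
            case False
            hence "ln (real M) \<le> ln (real k)" using M by simp
            hence "ln (real M) * (\<psi> k * real k powr - s) \<le> ln (real k) * (\<psi> k * real k powr - s)"
              using u by (rule mult_right_mono)
            thus ?thesis using False by (simp add: mult_ac)
          qed
        qed
        have "(\<Sum>k=1..<n. if k < M then ln (real M) else 0) = (\<Sum>k\<in>{k \<in> {1..<n}. k < M}. ln (real M))"
          by (rule sum.inter_filter[symmetric]) simp
        also have "\<dots> \<le> (\<Sum>k<M. ln (real M))" using lnM0 by (intro sum_mono2) auto
        finally show ?thesis using 1 by (simp add: sum.distrib)
      qed
      thus "\<exists>N. \<forall>n\<ge>N. ln (real M) * (\<Sum>k=1..<n. \<psi> k * real k powr - s)
          \<le> (\<Sum>k=1..<n. \<psi> k * ln k * real k powr - s) + real M * ln (real M)" by blast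
    qed
    moreover have Lp: "L s \<ge> 0" using elim lnM0 by (smt (verit) mult_nonneg_nonneg of_nat_0_le_iff)
    hence "L s * F s \<le> L s * B" using elim by (intro mult_left_mono)
    moreover have "L s * (B + 1) \<le> L s * ln (real M)" using Lp lnM by (intro mult_left_mono)
    ultimately have "L s \<le> real M * ln (real M)" by (simp add: algebra_simps)
    thus False using elim by linarith
  qed
  thus False by simp
qed

end

section \<open>Cancellation in character sums and the extraction of a prime\<close>

lemma has_sum_finite_sum:
  fixes f :: "'i \<Rightarrow> 'a \<Rightarrow> real"
  assumes "finite S" "\<And>i. i \<in> S \<Longrightarrow> (f i has_sum a i) A"
  shows "((\<lambda>x. \<Sum>i\<in>S. f i x) has_sum (\<Sum>i\<in>S. a i)) A"
  using assms by (induction S rule: finite_induct) (auto intro!: has_sum_add)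

text \<open>Complete periods cancel, so every initial sum is at most K in absolute value, and any
  range is a difference of two initial ones.\<close>

lemma periodic_zero_sum_bounded:
  fixes f :: "nat \<Rightarrow> real"
  assumes "\<And>n. f (n + K) = f n" "(\<Sum>k<K. f k) = 0" "K > 0" "\<And>n. \<bar>f n\<bar> \<le> 1"
  shows "\<bar>\<Sum>k=m..<n. f k\<bar> \<le> 2 * real K"
proof -
  have shift: "(\<Sum>k<n + K. f k) = (\<Sum>k<n. f k)" for n
    by (induction n) (simp_all add: assms)
  have *: "\<bar>\<Sum>k<n. f k\<bar> \<le> real K" for n
  proof (induction n rule: less_induct)
    case (less n)
    show ?case
    proof (cases "n < K")
      case True
      have "\<bar>\<Sum>k<n. f k\<bar> \<le> (\<Sum>k<n. 1)" by (intro order.trans[OF sum_abs] sum_mono assms)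
      thus ?thesis using True by simp
    next
      case False
      thus ?thesis using shift[of "n - K"] less.IH[of "n - K"] assms(3) by simp
    qed
  qed
  show ?thesis
  proof (cases "m \<le> n")
    case True
    have "(\<Sum>k<n. f k) = (\<Sum>k<m. f k) + (\<Sum>k=m..<n. f k)"
      using sum.atLeastLessThan_concat[of 0 m n f] True by (simp add: atLeast0LessThan)
    thus ?thesis using *[of m] *[of n] by linarith
  qed simp
qed

text \<open>Multiplication by a permutes the residues mod K and changes the sign of the sum.\<close>

lemma multiplicative_zero_sum:
  fixes f :: "nat \<Rightarrow> real"
  assumes periodic: "\<And>n. f (n mod K) = f n" and mult: "\<And>n. f (a * n) = f a * f n"
    and a: "coprime a K" "f a = -1" and "K > 0"
  shows "(\<Sum>k<K. f k) = 0"
proof -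
  define h where "h = (\<lambda>k. a * k mod K)"
  have "inj_on h {..<K}"
  proof (rule inj_onI)
    fix x y assume xy: "x \<in> {..<K}" "y \<in> {..<K}" "h x = h y"
    hence "[a * x = a * y] (mod K)" by (simp add: h_def cong_def)
    hence "[x = y] (mod K)" using a(1) by (simp add: cong_mult_lcancel_nat coprime_commute)
    thus "x = y" using xy by (simp add: cong_def)
  qed
  moreover have "h ` {..<K} \<subseteq> {..<K}" using \<open>K > 0\<close> by (auto simp: h_def)
  ultimately have bij: "bij_betw h {..<K} {..<K}" by (simp add: bij_betw_def endo_inj_surj)
  have "(\<Sum>k<K. f k) = (\<Sum>k<K. f (h k))" by (rule sum.reindex_bij_betw[OF bij, symmetric])
  also have "\<dots> = (\<Sum>k<K. - f k)" by (simp add: h_def periodic mult a(2))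
  also have "\<dots> = - (\<Sum>k<K. f k)" by (rule sum_negf)
  finally show ?thesis by simp
qed

text \<open>Prime powers \<open>q ^ k\<close> with the prescribed signs cause no trouble: since one of the signs
  is \<open>-1\<close>, the exponent \<open>k\<close> is odd, so \<open>q\<close> itself has these signs.\<close>

theorem prime_with_character_values:
  fixes f :: "'i \<Rightarrow> nat \<Rightarrow> real" and \<epsilon> :: "'i \<Rightarrow> real" and K :: nat
  assumes "finite I" "K > 1"
    and mult: "\<And>i m n. i \<in> I \<Longrightarrow> coprime m K \<Longrightarrow> coprime n K \<Longrightarrow> f i (m * n) = f i m * f i n"
    and one: "\<And>i. i \<in> I \<Longrightarrow> f i 1 = 1"
    and vals: "\<And>i n. i \<in> I \<Longrightarrow> coprime n K \<Longrightarrow> f i n = 1 \<or> f i n = -1"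
    and periodic: "\<And>i n. i \<in> I \<Longrightarrow> f i (n mod K) = f i n"
    and indep: "\<And>i. i \<in> I \<Longrightarrow> \<exists>a. coprime a K \<and> f i a = -1 \<and> (\<forall>j\<in>I - {i}. f j a = 1)"
    and \<epsilon>: "\<And>i. i \<in> I \<Longrightarrow> \<epsilon> i = 1 \<or> \<epsilon> i = -1" "i0 \<in> I" "\<epsilon> i0 = -1"
  shows "\<exists>q. prime q \<and> coprime q K \<and> (\<forall>i\<in>I. f i q = \<epsilon> i)"
proof (rule ccontr)
  assume "\<not> ?thesis"
  hence none: "\<exists>i\<in>I. f i q \<noteq> \<epsilon> i" if "prime q" "coprime q K" for q using that by blast
  \<comment> \<open>One character for each subset of the given ones; the empty subset yields the
    principal character mod K.\<close>
  define X where "X = (\<lambda>S n. if coprime n K then \<Prod>i\<in>S. f i n else 0)"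
  have X: "real_character (X S)" if "S \<subseteq> I" for S
  proof
    show "X S (m * n) = X S m * X S n" for m n
      using that mult by (auto simp: X_def prod.distrib[symmetric] intro!: prod.cong)
    show "X S 1 = 1" using that one by (auto simp: X_def intro!: prod.neutral)
    show "X S 0 = 0" using \<open>K > 1\<close> by (auto simp: X_def)
    show "X S n = 1 \<or> X S n = 0 \<or> X S n = -1" for n
    proof (cases "coprime n K")
      case True
      have "finite S" using that \<open>finite I\<close> by (rule finite_subset)
      hence "(\<Prod>i\<in>S. f i n) = 1 \<or> (\<Prod>i\<in>S. f i n) = -1"
        using that
      proof (induction S rule: finite_induct)
        case (insert i S)
        thus ?case using vals[of i n] True by auto
      qed auto
      thus ?thesis by (auto simp: X_def)
    qed (simp add: X_def)
  qed
  have nonprincipal: "nonprincipal_character (X S) (2 * real K)" if S: "S \<subseteq> I" "S \<noteq> {}" for S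
  proof -
    interpret real_character "X S" using S by (intro X)
    have per: "X S (n mod K) = X S n" for n
    proof -
      have "coprime (n mod K) K \<longleftrightarrow> coprime n K" using \<open>K > 1\<close> by (simp add: coprime_mod_left_iff)
      moreover have "(\<Prod>i\<in>S. f i (n mod K)) = (\<Prod>i\<in>S. f i n)" using S periodic by (intro prod.cong) auto
      ultimately show ?thesis by (simp add: X_def)
    qed
    \<comment> \<open>Independence at any i in S provides a residue where only the factor i is
      negative, so the product is -1 there.\<close>
    obtain i where i: "i \<in> S" using S by blast
    then obtain a where a: "coprime a K" "f i a = -1" "\<forall>j\<in>I - {i}. f j a = 1"
      using indep S by blast
    have "finite S" using S \<open>finite I\<close> finite_subset by blast
    have "(\<Prod>j\<in>S. f j a) = f i a * (\<Prod>j\<in>S - {i}. f j a)" using i \<open>finite S\<close> by (simp add: prod.remove)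
    also have "(\<Prod>j\<in>S - {i}. f j a) = 1" using a(3) S by (intro prod.neutral) auto
    finally have "X S a = -1" using a by (simp add: X_def)
    hence zero: "(\<Sum>k<K. X S k) = 0"
      using per mult a(1) \<open>K > 1\<close> by (intro multiplicative_zero_sum[of "X S" K a]) auto
    have "X S (n + K) = X S n" for n using per[of "n + K"] per[of n] by simp
    thus ?thesis
      by unfold_locales (rule periodic_zero_sum_bounded, use zero \<open>K > 1\<close> abs_le_1 in auto)
  qed
  have principal: "principal_character (X {}) K"
  proof -
    interpret real_character "X {}" by (intro X) simp
    have cop: "coprime (K * j + 1) K" for j
    proof (rule coprimeI)
      fix c assume "c dvd K * j + 1" "c dvd K"
      thus "is_unit c" using dvd_add_right_iff[of c "K * j" 1] by auto
    qed
    show ?thesis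
    proof
      show "X {} (K * j + 1) = 1" for j using cop[of j] by (simp add: X_def)
    qed (use \<open>K > 1\<close> in \<open>auto simp: X_def\<close>)
  qed
  define F where "F = (\<lambda>S s. infsum (\<lambda>n. X S n * mangoldt n * real n powr - s) {0<..})"
  define e where "e = (\<lambda>S. \<Prod>i\<in>S. \<epsilon> i)"
  \<comment> \<open>For n coprime to K the sum over subsets is the expanded product of the
    \<open>\<epsilon> i * f i n + 1\<close>, which vanishes unless all signs are right. A surviving
    prime power would therefore yield the prime that is assumed not to exist.\<close>
  have zero: "mangoldt n * (\<Sum>S\<in>Pow I. e S * X S n) = 0" for n
  proof (rule ccontr)
    assume "\<not> ?thesis"
    hence nz: "(mangoldt n :: real) \<noteq> 0" "(\<Sum>S\<in>Pow I. e S * X S n) \<noteq> 0" by auto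
    have cop: "coprime n K" using nz(2) by (auto simp: X_def intro: ccontr)
    have "primepow n" using nz(1) by (simp add: mangoldt_def split: if_splits)
    then obtain p k where pk: "prime p" "k > 0" "n = p ^ k" by (auto simp: primepow_def)
    have copp: "coprime p K" using cop pk by (simp add: coprime_power_left_iff)
    have "(\<Sum>S\<in>Pow I. e S * X S n) = (\<Prod>i\<in>I. \<epsilon> i * f i n + 1)"
      using cop prod_add[OF \<open>finite I\<close>, of "\<lambda>i. \<epsilon> i * f i n" "\<lambda>_. 1"]
      by (simp add: X_def e_def prod.distrib)
    hence "\<epsilon> i * f i n + 1 \<noteq> 0" if "i \<in> I" for i using nz(2) that \<open>finite I\<close> by auto
    hence pat: "f i n = \<epsilon> i" if "i \<in> I" for i
      using that \<epsilon>(1)[of i] vals[OF that cop] by fastforce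
    have pow: "f i (p ^ j) = f i p ^ j" if "i \<in> I" for i j
      using that one mult[OF that copp] copp by (induction j) (auto simp: coprime_power_left_iff)
    have "odd k"
    proof
      assume "even k"
      hence "f i0 n = 1" using pow[OF \<epsilon>(2), of k] vals[OF \<epsilon>(2) copp] pk(3) by auto
      thus False using pat[OF \<epsilon>(2)] \<epsilon>(3) by simp
    qed
    hence "f i p = \<epsilon> i" if "i \<in> I" for i
      using pow[OF that, of k] pat[OF that] vals[OF that copp] pk(3) by auto
    thus False using none[OF pk(1) copp] by blast
  qed
  have sumF: "(\<Sum>S\<in>Pow I. e S * F S s) = 0" if s: "s > 1" for s
  proof -
    have "((\<lambda>n. \<Sum>S\<in>Pow I. e S * (X S n * mangoldt n * real n powr - s)) has_sum (\<Sum>S\<in>Pow I. e S * F S s)) {0<..}"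
      unfolding F_def using X s
      by (intro has_sum_finite_sum has_sum_cmult_right has_sum_infsum real_character.summable_on_L_mangoldt)
         (use \<open>finite I\<close> in auto)
    moreover have "(\<Sum>S\<in>Pow I. e S * (X S n * mangoldt n * real n powr - s)) = 0" for n
    proof -
      have "(\<Sum>S\<in>Pow I. e S * (X S n * mangoldt n * real n powr - s))
          = mangoldt n * (\<Sum>S\<in>Pow I. e S * X S n) * real n powr - s"
        unfolding sum_distrib_left sum_distrib_right by (intro sum.cong) (simp_all add: mult_ac)
      thus ?thesis using zero by simp
    qed
    ultimately have "((\<lambda>n::nat. 0::real) has_sum (\<Sum>S\<in>Pow I. e S * F S s)) {0<..}" by simp
    thus ?thesis using infsumI by fastforce
  qed
  have "\<exists>B. \<forall>\<^sub>F s in at_right 1. \<bar>F S s\<bar> \<le> B" if "S \<in> Pow I - {{}}" for S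
  proof -
    have S: "S \<subseteq> I" "S \<noteq> {}" using that by auto
    show ?thesis
      using nonprincipal_character.F_bounded[OF nonprincipal[OF S]]
      unfolding F_def real_character.F_def[OF X[OF S(1)]] .
  qed
  then obtain B where "\<And>S. S \<in> Pow I - {{}} \<Longrightarrow> \<forall>\<^sub>F s in at_right 1. \<bar>F S s\<bar> \<le> B S" by metis
  hence "\<forall>\<^sub>F s in at_right 1. \<forall>S\<in>Pow I - {{}}. \<bar>F S s\<bar> \<le> B S"
    using \<open>finite I\<close> by (intro eventually_ball_finite) auto
  \<comment> \<open>The vanishing combination expresses the principal term through the nonprincipal
    ones, so it would be bounded above.\<close>
  hence "\<forall>\<^sub>F s in at_right 1. F {} s \<le> (\<Sum>S\<in>Pow I - {{}}. B S)"
    using eventually_at_right_less[of 1]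
  proof eventually_elim
    case (elim s)
    have "(\<Sum>S\<in>Pow I. e S * F S s) = e {} * F {} s + (\<Sum>S\<in>Pow I - {{}}. e S * F S s)"
      using \<open>finite I\<close> by (intro sum.remove) auto
    hence "F {} s = - (\<Sum>S\<in>Pow I - {{}}. e S * F S s)" using sumF elim by (simp add: e_def)
    also have "\<dots> \<le> \<bar>\<Sum>S\<in>Pow I - {{}}. e S * F S s\<bar>" by simp
    also have "\<dots> \<le> (\<Sum>S\<in>Pow I - {{}}. \<bar>e S * F S s\<bar>)" by (rule sum_abs)
    also have "\<dots> \<le> (\<Sum>S\<in>Pow I - {{}}. B S)"
    proof (rule sum_mono)
      fix S assume S: "S \<in> Pow I - {{}}"
      have "\<bar>e S\<bar> = (\<Prod>i\<in>S. \<bar>\<epsilon> i\<bar>)" unfolding e_def by (rule abs_prod)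
      also have "\<dots> = 1" using S \<epsilon>(1) by (intro prod.neutral) force
      finally show "\<bar>e S * F S s\<bar> \<le> B S" using elim S by (simp add: abs_mult)
    qed
    finally show ?case .
  qed
  moreover have "F {} s = real_character.F (X {}) s" for s
    unfolding F_def real_character.F_def[OF X[OF empty_subsetI]] ..
  ultimately show False using principal_character.F_unbounded[OF principal] by simp
qed

section \<open>Rational and integral sums of three squares\<close>

definition sum3sq :: "int \<Rightarrow> bool" where
  "sum3sq n \<longleftrightarrow> (\<exists>a b c. n = a\<^sup>2 + b\<^sup>2 + c\<^sup>2)"

lemma nearest_multiple:
  fixes t x :: int
  assumes "t > 0"
  obtains k where "4 * (x - t * k)\<^sup>2 \<le> t\<^sup>2"
proof -
  \<comment> \<open>Rounding to the nearest integer: the floor of x / t + 1/2.\<close>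
  define k where "k = (2 * x + t) div (2 * t)"
  have "2 * x + t = 2 * t * k + (2 * x + t) mod (2 * t)"
    unfolding k_def by simp
  moreover have "0 \<le> (2 * x + t) mod (2 * t)" "(2 * x + t) mod (2 * t) < 2 * t"
    using assms by simp_all
  ultimately have "\<bar>2 * (x - t * k)\<bar> \<le> \<bar>t\<bar>" by (simp add: algebra_simps)
  hence "(2 * (x - t * k))\<^sup>2 \<le> t\<^sup>2" by (simp only: abs_le_square_iff)
  hence "4 * (x - t * k)\<^sup>2 \<le> t\<^sup>2" by (subst (asm) power_mult_distrib) simp
  thus ?thesis by (rule that)
qed

text \<open>The Davenport--Cassels descent: the line through a rational point of denominator \<open>t\<close>
  on the sphere and the nearest lattice point meets the sphere again in a point of smaller
  denominator.\<close>

lemma davenport_cassels: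
  assumes "n * t\<^sup>2 = x\<^sup>2 + y\<^sup>2 + z\<^sup>2" "t > 0"
  shows "sum3sq n"
  using assms
proof (induction "nat t" arbitrary: t x y z rule: less_induct)
  case less
  obtain x0 where x0: "4 * (x - t * x0)\<^sup>2 \<le> t\<^sup>2" using less.prems(2) by (rule nearest_multiple)
  obtain y0 where y0: "4 * (y - t * y0)\<^sup>2 \<le> t\<^sup>2" using less.prems(2) by (rule nearest_multiple)
  obtain z0 where z0: "4 * (z - t * z0)\<^sup>2 \<le> t\<^sup>2" using less.prems(2) by (rule nearest_multiple)
  \<comment> \<open>The second intersection point has numerators a x + b x0 (likewise for y and z)
    over t'. By \<open>dist\<close>, t' is t times the squared distance from the rational point to
    the lattice point; that is at most 3/4, so t' < t.\<close>
  define a where "a = x0\<^sup>2 + y0\<^sup>2 + z0\<^sup>2 - n"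
  define b where "b = 2 * (n * t - (x * x0 + y * y0 + z * z0))"
  define t' where "t' = a * t + b"
  have dist: "(x - t * x0)\<^sup>2 + (y - t * y0)\<^sup>2 + (z - t * z0)\<^sup>2 = t * t'"
    using less.prems(1) unfolding t'_def a_def b_def
    by (simp add: power2_eq_square algebra_simps)
  have "t\<^sup>2 > 0" using less.prems by simp
  hence "t * t' < t * t" using x0 y0 z0 dist by (simp add: power2_eq_square)
  hence "t' < t" using less.prems by simp
  have "t * t' \<ge> 0" unfolding dist[symmetric] by simp
  hence "t' \<ge> 0" using less.prems by (simp add: zero_le_mult_iff)
  show ?case
  proof (cases "t' = 0")
    case True
    have "(x - t * x0)\<^sup>2 + (y - t * y0)\<^sup>2 + (z - t * z0)\<^sup>2 = 0" using dist True by simp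
    hence "(x - t * x0)\<^sup>2 = 0" "(y - t * y0)\<^sup>2 = 0" "(z - t * z0)\<^sup>2 = 0"
      using zero_le_power2[of "x - t * x0"] zero_le_power2[of "y - t * y0"]
        zero_le_power2[of "z - t * z0"] by linarith+
    hence eqs: "x = t * x0" "y = t * y0" "z = t * z0" by simp_all
    have "n * t\<^sup>2 = (x0\<^sup>2 + y0\<^sup>2 + z0\<^sup>2) * t\<^sup>2"
      using less.prems(1) unfolding eqs by (simp add: power_mult_distrib algebra_simps)
    hence "n = x0\<^sup>2 + y0\<^sup>2 + z0\<^sup>2" using less.prems(2) by simp
    thus ?thesis unfolding sum3sq_def by blast
  next
    case False
    have "(a * x + b * x0)\<^sup>2 + (a * y + b * y0)\<^sup>2 + (a * z + b * z0)\<^sup>2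
        = a\<^sup>2 * (x\<^sup>2 + y\<^sup>2 + z\<^sup>2) + 2 * a * b * (x * x0 + y * y0 + z * z0) + b\<^sup>2 * (x0\<^sup>2 + y0\<^sup>2 + z0\<^sup>2)"
      by (simp add: power2_eq_square algebra_simps)
    also have "\<dots> = a\<^sup>2 * (n * t\<^sup>2) + a * b * (2 * n * t - b) + b\<^sup>2 * (n + a)"
      unfolding less.prems(1)[symmetric] by (simp add: a_def b_def algebra_simps)
    also have "\<dots> = n * t'\<^sup>2" by (simp add: t'_def power2_eq_square algebra_simps)
    finally have "n * t'\<^sup>2 = (a * x + b * x0)\<^sup>2 + (a * y + b * y0)\<^sup>2 + (a * z + b * z0)\<^sup>2" ..
    moreover have "t' > 0" "nat t' < nat t" using False \<open>t' \<ge> 0\<close> \<open>t' < t\<close> by simp_all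
    ultimately show ?thesis by (intro less.hyps)
  qed
qed

text \<open>Side lengths for the pigeonhole box: n \<le> B^2 makes the box large enough, while (B -
  1)^2 < n keeps differences of its points small.\<close>

lemma ceiling_sqrt:
  fixes n :: int
  assumes "n > 0"
  obtains B :: int where "B > 0" "(B - 1)\<^sup>2 < n" "n \<le> B\<^sup>2"
proof -
  define k where "k = (LEAST k::nat. n \<le> (int k)\<^sup>2)"
  have ex: "n \<le> (int (nat n))\<^sup>2" using assms by (simp add: power2_eq_square)
  have k: "n \<le> (int k)\<^sup>2" unfolding k_def by (rule LeastI[of _ "nat n"]) (rule ex)
  have "k \<noteq> 0" using k assms by (intro notI) simp
  have "\<not> n \<le> (int (k - 1))\<^sup>2"
    using not_less_Least[of "k - 1" "\<lambda>k. n \<le> (int k)\<^sup>2"] \<open>k \<noteq> 0\<close> unfolding k_def by simp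
  thus ?thesis using that[of "int k"] k \<open>k \<noteq> 0\<close> by (simp add: of_nat_diff)
qed

lemma square_diff_le:
  fixes u v B :: int
  assumes "u \<in> {0..<B}" "v \<in> {0..<B}"
  shows "(u - v)\<^sup>2 \<le> (B - 1)\<^sup>2"
proof -
  have "\<bar>u - v\<bar> \<le> \<bar>B - 1\<bar>" using assms by auto
  thus ?thesis by (simp only: abs_le_square_iff)
qed

text \<open>Pigeonhole in a box: the two congruences make \<open>z\<^sup>2 + m s\<^sup>2 - n t\<^sup>2\<close> a multiple of \<open>n m\<close>,
  and the size of the box leaves only the values \<open>0\<close> and \<open>n m\<close>.\<close>

lemma legendre_pigeonhole:
  fixes n m \<alpha> \<beta> :: int
  assumes "n > 0" "m > 0" "coprime n m" "n dvd \<alpha>\<^sup>2 + m" "m dvd \<beta>\<^sup>2 - n"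
  obtains z s t where "n * t\<^sup>2 = z\<^sup>2 + m * s\<^sup>2" "t > 0"
proof -
  have "n * m + 1 > 0" using assms by (simp add: add_pos_pos)
  \<comment> \<open>The side for z is built from n m + 1, so that the box has strictly more than n m
    points; squared differences are still at most n m.\<close>
  then obtain A where A: "A > 0" "(A - 1)\<^sup>2 < n * m + 1" "n * m + 1 \<le> A\<^sup>2" by (rule ceiling_sqrt)
  obtain B where B: "B > 0" "(B - 1)\<^sup>2 < n" "n \<le> B\<^sup>2" using assms(1) by (rule ceiling_sqrt)
  obtain C where C: "C > 0" "(C - 1)\<^sup>2 < m" "m \<le> C\<^sup>2" using assms(2) by (rule ceiling_sqrt)
  define X where "X = {0..<A} \<times> {0..<B} \<times> {0..<C}"
  \<comment> \<open>A coincidence gives differences with z = \<alpha> s mod n and z = \<beta> t mod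
    m, hence z^2 = -m s^2 mod n and z^2 = n t^2 mod m.\<close>
  define f where "f = (\<lambda>(z, s, t). ((z - \<alpha> * s) mod n, (z - \<beta> * t) mod m))"
  have "(n * m)\<^sup>2 < (A * B * C)\<^sup>2"
  proof -
    have "(n * m)\<^sup>2 < (n * m + 1) * (n * m)" using assms by (simp add: power2_eq_square algebra_simps)
    also have "\<dots> \<le> A\<^sup>2 * (B\<^sup>2 * C\<^sup>2)" using A B C assms by (intro mult_mono) auto
    finally show ?thesis by (simp add: power_mult_distrib mult.assoc)
  qed
  hence "n * m < A * B * C" using A B C by (intro power2_less_imp_less[of "n * m"]) auto
  hence "nat (n * m) < nat (A * B * C)" using A B C by simp
  moreover have "card X = nat (A * B * C)"
    unfolding X_def using A B C by (simp add: nat_mult_distrib mult.assoc)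
  moreover have "card ({0..<n} \<times> {0..<m}) = nat (n * m)" using assms by (simp add: nat_mult_distrib)
  moreover have "f ` X \<subseteq> {0..<n} \<times> {0..<m}" using assms by (auto simp: f_def)
  ultimately have "\<not> inj_on f X"
    using card_inj_on_le[of f X "{0..<n} \<times> {0..<m}"] by auto
  then obtain p1 p2 where p: "p1 \<in> X" "p2 \<in> X" "p1 \<noteq> p2" "f p1 = f p2"
    unfolding inj_on_def by blast
  obtain z1 s1 t1 where p1: "p1 = (z1, s1, t1)" by (cases p1) auto
  obtain z2 s2 t2 where p2: "p2 = (z2, s2, t2)" by (cases p2) auto
  define z where "z = z1 - z2"
  define s where "s = s1 - s2"
  define t where "t = t1 - t2"
  have nz: "z \<noteq> 0 \<or> s \<noteq> 0 \<or> t \<noteq> 0" using p(3) by (auto simp: p1 p2 z_def s_def t_def)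
  have bounds: "z\<^sup>2 \<le> n * m" "s\<^sup>2 < n" "t\<^sup>2 < m"
    using square_diff_le[of z1 A z2] square_diff_le[of s1 B s2] square_diff_le[of t1 C t2] p(1,2) A B C
    unfolding X_def p1 p2 z_def s_def t_def by auto
  have "n dvd z - \<alpha> * s"
    using p(4) unfolding f_def p1 p2 z_def s_def
    by (auto simp: mod_eq_dvd_iff algebra_simps)
  hence "n dvd (z - \<alpha> * s) * (z + \<alpha> * s) + (\<alpha>\<^sup>2 + m) * s\<^sup>2 - n * t\<^sup>2"
    using assms(4) by (rule dvd_diff[OF dvd_add[OF dvd_mult2 dvd_mult2] dvd_triv_left])
  also have "(z - \<alpha> * s) * (z + \<alpha> * s) + (\<alpha>\<^sup>2 + m) * s\<^sup>2 - n * t\<^sup>2 = z\<^sup>2 + m * s\<^sup>2 - n * t\<^sup>2"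
    by (simp add: power2_eq_square algebra_simps)
  finally have 1: "n dvd z\<^sup>2 + m * s\<^sup>2 - n * t\<^sup>2" .
  have "m dvd z - \<beta> * t"
    using p(4) unfolding f_def p1 p2 z_def t_def
    by (auto simp: mod_eq_dvd_iff algebra_simps)
  hence "m dvd (z - \<beta> * t) * (z + \<beta> * t) + (\<beta>\<^sup>2 - n) * t\<^sup>2 + m * s\<^sup>2"
    using assms(5) by (rule dvd_add[OF dvd_add[OF dvd_mult2 dvd_mult2] dvd_triv_left])
  also have "(z - \<beta> * t) * (z + \<beta> * t) + (\<beta>\<^sup>2 - n) * t\<^sup>2 + m * s\<^sup>2 = z\<^sup>2 + m * s\<^sup>2 - n * t\<^sup>2"
    by (simp add: power2_eq_square algebra_simps)
  finally have "n * m dvd z\<^sup>2 + m * s\<^sup>2 - n * t\<^sup>2" using 1 assms(3) by (intro divides_mult)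
  then obtain k where k: "z\<^sup>2 + m * s\<^sup>2 - n * t\<^sup>2 = n * m * k" by blast
  have pos: "n * m > 0" using assms by simp
  have "m * s\<^sup>2 < n * m" "n * t\<^sup>2 < n * m" using bounds assms by (simp_all add: mult.commute)
  moreover have "z\<^sup>2 \<ge> 0" "m * s\<^sup>2 \<ge> 0" "n * t\<^sup>2 \<ge> 0" using assms by simp_all
  ultimately have "n * m * (-1) < n * m * k" "n * m * k < n * m * 2"
    using bounds k by linarith+
  hence "-1 < k" "k < 2" using pos by (simp_all only: mult_less_cancel_left_pos)
  hence "k = 0 \<or> k = 1" by arith
  thus thesis
  proof
    assume "k = 0"
    hence eq: "n * t\<^sup>2 = z\<^sup>2 + m * s\<^sup>2" using k by simp
    have "t \<noteq> 0"
    proof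
      assume "t = 0"
      hence "z\<^sup>2 + m * s\<^sup>2 = 0" using eq by simp
      moreover have "z\<^sup>2 \<ge> 0" "m * s\<^sup>2 \<ge> 0" using assms by simp_all
      ultimately have "z\<^sup>2 = 0" "m * s\<^sup>2 = 0" by linarith+
      thus False using nz \<open>t = 0\<close> assms by simp
    qed
    thus thesis using that[of "\<bar>t\<bar>" z s] eq by simp
  next
    assume "k = 1"
    \<comment> \<open>Multiplying by t^2 + m, the value of X^2 + m Y^2 at (t, 1), and using
      Brahmagupta's identity gives a solution with t^2 + m in place of t.\<close>
    hence "z\<^sup>2 + m * s\<^sup>2 = n * (t\<^sup>2 + m)" using k by (simp add: algebra_simps)
    hence "n * (t\<^sup>2 + m)\<^sup>2 = (z\<^sup>2 + m * s\<^sup>2) * (t\<^sup>2 + m)" by (simp add: power2_eq_square)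
    also have "\<dots> = (z * t - m * s)\<^sup>2 + m * (z + s * t)\<^sup>2"
      by (simp add: power2_eq_square algebra_simps)
    finally show thesis using that assms(2) by (simp add: add_nonneg_pos)
  qed
qed

lemma sum3sq_of_local_conditions:
  fixes n q e :: int
  assumes "n > 0" "q > 0" "e = 1 \<or> e = 2" "coprime n (e * q)"
    and "n dvd \<alpha>\<^sup>2 + e * q" "e * q dvd \<beta>\<^sup>2 - n" "q dvd \<gamma>\<^sup>2 + 1"
  shows "sum3sq n"
proof -
  have "e * q > 0" using assms by auto
  obtain t z s where 1: "n * t\<^sup>2 = z\<^sup>2 + (e * q) * s\<^sup>2" "t > 0"
    using legendre_pigeonhole[OF assms(1) \<open>e * q > 0\<close> assms(4-6)] by blast
  \<comment> \<open>With second modulus 1 only the condition mod q remains, namely that -1 is a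
    square; the outcome is a rational two squares theorem for q.\<close>
  obtain u a b where 2: "q * u\<^sup>2 = a\<^sup>2 + 1 * b\<^sup>2" "u > 0"
    by (rule legendre_pigeonhole[of q 1 \<gamma> 0]) (use assms in auto)
  obtain c d where cd: "e * q * u\<^sup>2 = c\<^sup>2 + d\<^sup>2"
  proof (cases "e = 1")
    case True
    thus thesis using that[of a b] 2 by simp
  next
    case False
    hence "e * q * u\<^sup>2 = 2 * (a\<^sup>2 + b\<^sup>2)" using assms(3) 2 by simp
    also have "\<dots> = (a + b)\<^sup>2 + (a - b)\<^sup>2" by (simp add: power2_eq_square algebra_simps)
    finally show thesis by (rule that)
  qed
  have "n * (t * u)\<^sup>2 = (n * t\<^sup>2) * u\<^sup>2" by (simp add: power_mult_distrib)
  also have "\<dots> = (z * u)\<^sup>2 + s\<^sup>2 * (e * q * u\<^sup>2)" unfolding 1 by (simp add: power2_eq_square algebra_simps)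
  also have "\<dots> = (z * u)\<^sup>2 + (s * c)\<^sup>2 + (s * d)\<^sup>2" unfolding cd by (simp add: power_mult_distrib algebra_simps)
  finally show ?thesis by (rule davenport_cassels) (use 1 2 in simp)
qed

section \<open>Legendre symbols\<close>

lemma Legendre_values: "Legendre a p = -1 \<or> Legendre a p = 0 \<or> Legendre a p = 1"
  by (auto simp: Legendre_def)

lemma Legendre_eq_0_iff: "Legendre a p = 0 \<longleftrightarrow> p dvd a"
  by (auto simp: Legendre_def cong_0_iff)

lemma Legendre_cong: "[a = b] (mod p) \<Longrightarrow> Legendre a p = Legendre b p"
  by (simp add: Legendre_def QuadRes_def cong_def)

text \<open>Upgrades congruences between values in -1, 0, 1, as in Euler's criterion, to
  equalities.\<close>

lemma small_cong_imp_eq: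
  fixes u v :: int and p :: nat
  assumes "[u = v] (mod int p)" "p > 2" "\<bar>u\<bar> \<le> 1" "\<bar>v\<bar> \<le> 1"
  shows "u = v"
proof -
  have "int p dvd u - v" using assms(1) by (simp add: cong_iff_dvd_diff)
  moreover have "\<bar>u - v\<bar> < int p" using assms by arith
  ultimately show ?thesis by (metis dvd_imp_le_int eq_iff_diff_eq_0 abs_of_nat not_less)
qed

lemma abs_Legendre_le_1: "\<bar>Legendre a p\<bar> \<le> 1"
  by (auto simp: Legendre_def)

lemma Legendre_1:
  assumes "p > 1"
  shows "Legendre 1 (int p) = 1"
proof -
  have "QuadRes (int p) 1" unfolding QuadRes_def by (rule exI[of _ 1]) simp
  thus ?thesis using assms by (auto simp: Legendre_def cong_0_iff)
qed

lemma Legendre_mult: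
  assumes "prime p" "p > 2"
  shows "Legendre (a * b) (int p) = Legendre a (int p) * Legendre b (int p)"
proof (rule small_cong_imp_eq[OF _ assms(2)])
  have "[Legendre a p * Legendre b p = a ^ ((p - 1) div 2) * b ^ ((p - 1) div 2)] (mod int p)"
    using assms by (intro cong_mult euler_criterion)
  thus "[Legendre (a * b) (int p) = Legendre a (int p) * Legendre b (int p)] (mod int p)"
    using euler_criterion[OF assms, of "a * b"]
    unfolding power_mult_distrib by (metis cong_sym cong_trans)
  show "\<bar>Legendre a (int p) * Legendre b (int p)\<bar> \<le> 1"
    using abs_Legendre_le_1[of a "int p"] abs_Legendre_le_1[of b "int p"]
    by (simp add: abs_mult mult_le_one)
qed (rule abs_Legendre_le_1)

lemma Legendre_minus_1:
  assumes "prime p" "p > 2"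
  shows "Legendre (-1) (int p) = (if p mod 4 = 1 then 1 else -1)"
proof -
  have "Legendre (-1) (int p) = (-1) ^ ((p - 1) div 2)"
    using euler_criterion[OF assms, of "-1"]
    by (rule small_cong_imp_eq) (use assms abs_Legendre_le_1 in \<open>auto simp: power_abs\<close>)
  also have "\<dots> = (if p mod 4 = 1 then 1 else -1)"
  proof -
    have "odd p" using assms prime_odd_nat by auto
    then obtain k where k: "p = 2 * k + 1" by (elim oddE)
    have "even k \<longleftrightarrow> p mod 4 = 1" unfolding k by presburger
    thus ?thesis unfolding k by simp
  qed
  finally show ?thesis .
qed

lemma Legendre_2:
  assumes "prime p" "p > 2"
  shows "Legendre 2 (int p) = (if p mod 8 = 1 \<or> p mod 8 = 7 then 1 else -1)"
proof -
  interpret GAUSS p 2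
    using assms by unfold_locales (auto simp: cong_0_iff zdvd_not_zless)
  obtain h where h: "p = 2 * h + 1" using assms prime_odd_nat by (metis oddE less_not_refl)
  have A: "A = {0<..int h}" unfolding A_def by (simp add: h)
  have "C = (\<lambda>x. 2 * x) ` {0<..int h}"
    unfolding C_def B_def A image_image by (intro image_cong) (auto simp: h)
  \<comment> \<open>No 2 x with x \<le> h is reduced mod p, so Gauss's lemma counts the x with 2 x >
    h, that is, those above h div 2.\<close>
  hence "E = (\<lambda>x. 2 * x) ` {int (h div 2)<..int h}"
    unfolding E_def by (auto simp: image_iff h)
  hence "card E = h - h div 2" by (simp add: card_image inj_on_def)
  hence "Legendre 2 (int p) = (-1) ^ (h - h div 2)" using gauss_lemma by simp
  moreover have "even (h - h div 2) \<longleftrightarrow> p mod 8 = 1 \<or> p mod 8 = 7"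
  proof -
    have "h mod 4 = 0 \<or> h mod 4 = 1 \<or> h mod 4 = 2 \<or> h mod 4 = 3" by auto
    then obtain k where "h = 4 * k \<or> h = 4 * k + 1 \<or> h = 4 * k + 2 \<or> h = 4 * k + 3"
      by (metis add.right_neutral mult_div_mod_eq)
    thus ?thesis unfolding h by (elim disjE) (simp_all, presburger+)
  qed
  ultimately show ?thesis by simp
qed

lemma Legendre_reciprocity_1_mod_4:
  assumes "prime p" "p > 2" "prime q" "q mod 4 = 1" "p \<noteq> q"
  shows "Legendre (int p) (int q) = Legendre (int q) (int p)"
proof -
  obtain k where k: "q = 4 * k + 1" using assms(4) by (metis mult_div_mod_eq)
  have q: "q > 2" using k assms(3) prime_gt_1_nat[of q] by simp
  have "Legendre p q * Legendre q p = (-1) ^ ((p - 1) div 2 * ((q - 1) div 2))"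
    using assms q by (intro Quadratic_Reciprocity)
  also have "\<dots> = 1" unfolding k by simp
  finally show ?thesis
    using Legendre_values[of p q] Legendre_values[of q p] by auto
qed

lemma square_mod_prod_primes:
  fixes c :: int
  assumes "finite S" "\<And>p. p \<in> S \<Longrightarrow> prime (p::nat)" "\<And>p. p \<in> S \<Longrightarrow> \<exists>y. int p dvd y\<^sup>2 + c"
  shows "\<exists>y. int (\<Prod>S) dvd y\<^sup>2 + c"
  using assms
proof (induction S rule: finite_induct)
  case (insert p S)
  obtain u where u: "int p dvd u\<^sup>2 + c" using insert.prems by blast
  obtain v where v: "int (\<Prod>S) dvd v\<^sup>2 + c" using insert by blast
  have "coprime p (\<Prod>S)" using insert by (intro prod_coprime_right) (auto intro: primes_coprime)
  hence cop: "coprime (int p) (int (\<Prod>S))" by (simp only: coprime_int_iff)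
  then obtain y where y: "[y = u] (mod int p)" "[y = v] (mod int (\<Prod>S))"
    using binary_chinese_remainder_int by blast
  have "int p dvd y\<^sup>2 + c" using u y(1)
    by (simp add: cong_dvd_iff[OF cong_add[OF cong_pow cong_refl]])
  moreover have "int (\<Prod>S) dvd y\<^sup>2 + c" using v y(2)
    by (simp add: cong_dvd_iff[OF cong_add[OF cong_pow cong_refl]])
  ultimately have "int p * int (\<Prod>S) dvd y\<^sup>2 + c" using cop by (intro divides_mult)
  thus ?case using insert by auto
qed auto

text \<open>Odd residues mod 4 multiply like signs. Oddness belongs to the conclusion because the
  induction step relies on it to exclude the other residues.\<close>

lemma prod_Legendre_minus_1:
  assumes "finite S" "\<And>p. p \<in> S \<Longrightarrow> prime (p::nat) \<and> p > 2"
  shows "(\<Prod>p\<in>S. Legendre (-1) (int p)) = (if \<Prod>S mod 4 = 1 then 1 else -1) \<and> odd (\<Prod>S)"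
  using assms
proof (induction S rule: finite_induct)
  case (insert p S)
  have odd: "odd p" "odd (\<Prod>S)" using insert prime_odd_nat by auto
  have "p mod 4 = 1 \<or> p mod 4 = 3" "\<Prod>S mod 4 = 1 \<or> \<Prod>S mod 4 = 3" using odd by presburger+
  moreover have "(p * \<Prod>S) mod 4 = ((p mod 4) * (\<Prod>S mod 4)) mod 4" by (simp add: mod_mult_eq)
  moreover have "(\<Prod>p\<in>S. Legendre (-1) (int p)) = (if \<Prod>S mod 4 = 1 then 1 else -1)"
    using insert by blast
  moreover have "Legendre (-1) (int p) = (if p mod 4 = 1 then 1 else -1)"
    using insert.prems[of p] by (simp add: Legendre_minus_1)
  ultimately show ?case using insert.hyps odd by (elim disjE) simp_all
qed auto

text \<open>The symbol of -2 is 1 exactly at 1 and 3 mod 8. These form a subgroup of the units mod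
  8, so the criterion passes to products.\<close>

lemma prod_Legendre_minus_2:
  assumes "finite S" "\<And>p. p \<in> S \<Longrightarrow> prime (p::nat) \<and> p > 2"
  shows "(\<Prod>p\<in>S. Legendre (-2) (int p)) = (if \<Prod>S mod 8 = 1 \<or> \<Prod>S mod 8 = 3 then 1 else -1) \<and> odd (\<Prod>S)"
  using assms
proof (induction S rule: finite_induct)
  case (insert p S)
  have odd: "odd p" "odd (\<Prod>S)" using insert prime_odd_nat by auto
  have odd8: "m mod 8 = 1 \<or> m mod 8 = 3 \<or> m mod 8 = 5 \<or> m mod 8 = 7" if "odd m" for m :: nat
    using that by presburger
  have "Legendre (-2) (int p) = Legendre (-1) (int p) * Legendre 2 (int p)"
    using Legendre_mult[of p "-1" 2] insert.prems[of p] by simp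
  also have "\<dots> = (if p mod 8 = 1 \<or> p mod 8 = 3 then 1 else -1)"
  proof -
    have "p mod 4 = (p mod 8) mod 4" by (simp add: mod_mod_cancel)
    thus ?thesis using insert.prems[of p] odd8[OF odd(1)]
      by (elim disjE) (simp_all add: Legendre_minus_1 Legendre_2)
  qed
  finally have "Legendre (-2) (int p) = (if p mod 8 = 1 \<or> p mod 8 = 3 then 1 else -1)" .
  moreover have "(p * \<Prod>S) mod 8 = ((p mod 8) * (\<Prod>S mod 8)) mod 8" by (simp add: mod_mult_eq)
  moreover have "(\<Prod>p\<in>S. Legendre (-2) (int p)) = (if \<Prod>S mod 8 = 1 \<or> \<Prod>S mod 8 = 3 then 1 else -1)"
    using insert by blast
  ultimately show ?case using insert.hyps odd odd8[OF odd(1)] odd8[OF odd(2)]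
    by (elim disjE) simp_all
qed auto

lemma Legendre_prod:
  assumes "finite S" "prime q" "q > 2"
  shows "Legendre (int (\<Prod>S)) (int q) = (\<Prod>p\<in>S. Legendre (int p) (int q))"
  using assms(1)
proof (induction S rule: finite_induct)
  case empty
  show ?case using assms by (simp add: Legendre_1)
qed (use assms in \<open>simp add: Legendre_mult\<close>)

section \<open>Primes with prescribed Legendre symbols\<close>

lemma odd_mod_8: "odd n \<Longrightarrow> n mod 8 = 1 \<or> n mod 8 = 3 \<or> n mod 8 = 5 \<or> n mod 8 = (7::nat)"
  by presburger

text \<open>The indices \<open>0\<close> and \<open>2\<close>, which are not odd primes, encode the characters of conductor
  \<open>4\<close> and \<open>8\<close>.\<close>

definition quadratic_character :: "nat \<Rightarrow> nat \<Rightarrow> int" where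
  "quadratic_character i n =
     (if i = 0 then (if n mod 8 = 1 \<or> n mod 8 = 5 then 1 else -1)
      else if i = 2 then (if n mod 8 = 1 \<or> n mod 8 = 7 then 1 else -1)
      else Legendre (int n) (int i))"

lemma quadratic_character_mult:
  assumes "odd m" "odd n" "i = 0 \<or> i = 2 \<or> prime i \<and> i > 2"
  shows "quadratic_character i (m * n) = quadratic_character i m * quadratic_character i n"
proof (cases "i = 0 \<or> i = 2")
  case True
  have "(m * n) mod 8 = ((m mod 8) * (n mod 8)) mod 8" by (simp add: mod_mult_eq)
  thus ?thesis using True odd_mod_8[OF assms(1)] odd_mod_8[OF assms(2)]
    by (elim disjE) (simp_all add: quadratic_character_def)
next
  case False
  thus ?thesis using assms by (auto simp: quadratic_character_def Legendre_mult)
qed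

lemma quadratic_character_cong:
  assumes "[m = n] (mod (if i = 0 \<or> i = 2 then 8 else i))"
  shows "quadratic_character i m = quadratic_character i n"
proof (cases "i = 0 \<or> i = 2")
  case False
  hence "[int m = int n] (mod int i)" using assms by (simp add: cong_int_iff)
  thus ?thesis using False by (simp add: quadratic_character_def Legendre_cong)
qed (use assms in \<open>auto simp: quadratic_character_def cong_def\<close>)

text \<open>Squaring modulo \<open>p\<close> identifies \<open>1\<close> and \<open>p - 1\<close>, so it is not onto.\<close>

lemma exists_nonresidue:
  assumes "p > 2"
  obtains a where "Legendre (int a) (int p) = -1"
proof -
  define h where "h = (\<lambda>x::nat. x * x mod p)"
  have "h 1 = h (p - 1)"
  proof -
    obtain k where "p = k + 2" using assms by (metis add.commute le_Suc_ex less_imp_le_nat)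
    hence "(p - 1) * (p - 1) = 1 + p * k" by (simp add: algebra_simps)
    hence "(p - 1) * (p - 1) mod p = 1 mod p" by (simp only: mod_mult_self2)
    thus ?thesis by (simp add: h_def)
  qed
  moreover have "1 \<in> {..<p}" "p - 1 \<in> {..<p}" "1 \<noteq> p - 1" using assms by auto
  ultimately have "\<not> inj_on h {..<p}" unfolding inj_on_def by blast
  moreover have "h ` {..<p} \<subseteq> {..<p}" using assms by (auto simp: h_def)
  ultimately have "h ` {..<p} \<noteq> {..<p}" by (metis finite_lessThan eq_card_imp_inj_on)
  then obtain a where a: "a < p" "a \<notin> h ` {..<p}" using \<open>h ` {..<p} \<subseteq> {..<p}\<close> by blast
  have "h 0 = 0" by (simp add: h_def)
  hence "a \<noteq> 0" using a assms by (metis imageI lessThan_iff not_gr_zero less_nat_zero_code)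
  have "\<not> QuadRes (int p) (int a)"
  proof
    assume "QuadRes (int p) (int a)"
    then obtain y where y: "[y\<^sup>2 = int a] (mod int p)" by (auto simp: QuadRes_def)
    define x where "x = nat (y mod int p)"
    have x: "x < p" "int x = y mod int p" using assms by (auto simp: x_def nat_less_iff)
    have "int (h x) = (y mod int p * (y mod int p)) mod int p" by (simp add: h_def of_nat_mod x(2))
    also have "\<dots> = int a mod int p" using y by (simp add: cong_def power2_eq_square mod_mult_eq)
    also have "\<dots> = int a" using a by simp
    finally show False using a x by auto
  qed
  moreover have "\<not> [int a = 0] (mod int p)" using a \<open>a \<noteq> 0\<close> by (simp add: cong_0_iff nat_dvd_not_less)
  ultimately have "Legendre (int a) (int p) = -1" by (simp add: Legendre_def)
  thus ?thesis by (rule that)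
qed

text \<open>The independence required by \<open>prime_with_character_values\<close> comes from the
  Chinese remainder theorem and the existence of a nonresidue at each prime.\<close>

lemma prime_with_Legendre_symbols:
  fixes P :: "nat set" and \<epsilon> :: "nat \<Rightarrow> int"
  assumes P: "finite P" "\<And>p. p \<in> P \<Longrightarrow> prime p \<and> p > 2"
    and \<epsilon>: "\<And>p. p \<in> P \<Longrightarrow> \<epsilon> p = 1 \<or> \<epsilon> p = -1" and r: "r = 1 \<or> r = 5"
  obtains q where "prime q" "q mod 8 = r" "\<And>p. p \<in> P \<Longrightarrow> Legendre (int q) (int p) = \<epsilon> p"
proof -
  \<comment> \<open>The auxiliary prime \<open>l\<close> guarantees that one of the prescribed signs is \<open>-1\<close>.\<close>
  obtain l where l: "prime l" "l > Max (insert 2 P)" using bigger_prime by blast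
  hence l2: "l > 2" "l \<notin> P" using P(1) by auto
  define P' where "P' = insert l P"
  have P': "finite P'" "\<And>p. p \<in> P' \<Longrightarrow> prime p" "\<And>p. p \<in> P' \<Longrightarrow> p > 2"
    using P l l2 by (auto simp: P'_def)
  define I where "I = {0, 2} \<union> P'"
  define K where "K = 8 * \<Prod>P'"
  define f where "f = (\<lambda>i n. real_of_int (quadratic_character i n))"
  \<comment> \<open>The value 1 at index 0 makes q = 1 mod 4; the value at index 2 then separates 1
    from 5 mod 8.\<close>
  define \<delta> where "\<delta> = (\<lambda>i. if i = 0 then 1 else if i = 2 then (if r = 1 then 1 else -1) else if i = l then -1 else \<epsilon> i)"
  have kind: "i = 0 \<or> i = 2 \<or> prime i \<and> i > 2" if "i \<in> I" for i using that P' by (auto simp: I_def)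
  have oddK: "odd n" if "coprime n K" for n
    using that coprime_common_divisor[of n K 2] by (auto simp: K_def)
  have copK: "coprime n p" if "coprime n K" "p \<in> P'" for n p
  proof (rule coprime_divisors[OF dvd_refl _ that(1)])
    show "p dvd K" using dvd_prodI[OF P'(1) that(2), of "\<lambda>x. x"] by (simp add: K_def)
  qed
  have crt: "\<exists>a. a mod 8 = u \<and> (\<forall>p\<in>P'. [a = v p] (mod p))" if "u < 8" for u and v :: "nat \<Rightarrow> nat"
  proof -
    \<comment> \<open>Index 0 stands for the modulus 8 and cannot clash with \<open>P'\<close>,
      which consists of primes.\<close>
    define m where "m = (\<lambda>i. if i = 0 then 8 else i :: nat)"
    have "\<forall>i\<in>insert 0 P'. \<forall>j\<in>insert 0 P'. i \<noteq> j \<longrightarrow> coprime (m i) (m j)"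
    proof -
      have "coprime 8 p" "coprime p 8" if "p \<in> P'" for p
      proof -
        have "odd p" using P'(2,3)[OF that] prime_odd_nat by blast
        hence "coprime (2 ^ 3) p" "coprime p (2 ^ 3)" by (simp_all only: coprime_power_left_iff coprime_power_right_iff) simp_all
        thus "coprime 8 p" "coprime p 8" by simp_all
      qed
      thus ?thesis using P'(2,3) by (auto simp: m_def intro: primes_coprime)
    qed
    then obtain a where a: "\<forall>i\<in>insert 0 P'. [a = (if i = 0 then u else v i)] (mod m i)"
      using chinese_remainder_nat[of "insert 0 P'" m "\<lambda>i. if i = 0 then u else v i"] P'(1) by auto
    have "a mod 8 = u" using a that by (simp add: m_def cong_def)
    moreover have "\<forall>p\<in>P'. [a = v p] (mod p)"
    proof
      fix p assume p: "p \<in> P'"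
      thus "[a = v p] (mod p)" using a P'(3)[OF p] by (auto simp: m_def dest!: bspec[of _ _ p])
    qed
    ultimately show ?thesis by blast
  qed
  have copI: "coprime a K" if "odd a" "\<And>p. p \<in> P' \<Longrightarrow> Legendre (int a) (int p) \<noteq> 0" for a
  proof -
    have "coprime a p" if p: "p \<in> P'" for p
      using \<open>\<And>p. p \<in> P' \<Longrightarrow> Legendre (int a) (int p) \<noteq> 0\<close>[OF p] P'(2)[OF p]
        prime_imp_coprime[of p a] by (simp add: Legendre_eq_0_iff coprime_commute)
    moreover have "coprime a (2 ^ 3)" using that(1) by (simp only: coprime_power_right_iff) simp
    ultimately show ?thesis unfolding K_def by (simp add: prod_coprime_right)
  qed
  have "\<exists>q. prime q \<and> coprime q K \<and> (\<forall>i\<in>I. f i q = real_of_int (\<delta> i))"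
  proof (rule prime_with_character_values)
    show "finite I" using P' by (simp add: I_def)
    have "\<Prod>P' > 0" using P'(2) by (intro prod_pos) (auto intro: prime_gt_0_nat)
    thus "K > 1" by (simp add: K_def)
    show "f i (m * n) = f i m * f i n" if "i \<in> I" "coprime m K" "coprime n K" for i m n
      using quadratic_character_mult[of m n i] kind[OF that(1)] oddK that(2,3) by (simp add: f_def)
    show "f i 1 = 1" if "i \<in> I" for i
      using kind[OF that] Legendre_1[of i] by (auto simp: f_def quadratic_character_def)
    show "f i n = 1 \<or> f i n = -1" if i: "i \<in> I" and n: "coprime n K" for i n
    proof (cases "i = 0 \<or> i = 2")
      case False
      hence "i \<in> P'" using i by (auto simp: I_def)
      hence "coprime n i" using copK n by blast
      hence "\<not> int i dvd int n" using P'(2)[OF \<open>i \<in> P'\<close>] by (metis coprime_absorb_right int_dvd_int_iff not_prime_unit)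
      thus ?thesis using False Legendre_values[of "int n" "int i"]
        by (auto simp: f_def quadratic_character_def Legendre_eq_0_iff)
    qed (auto simp: f_def quadratic_character_def)
    show "f i (n mod K) = f i n" if i: "i \<in> I" for i n
    proof -
      have "(if i = 0 \<or> i = 2 then 8 else i) dvd K"
        using i P'(1) by (auto simp: I_def K_def intro!: dvd_mult dvd_prodI[of P' _ "\<lambda>x. x", simplified])
      hence "[n mod K = n] (mod (if i = 0 \<or> i = 2 then 8 else i))" by (simp add: cong_def mod_mod_cancel)
      thus ?thesis unfolding f_def by (simp only: quadratic_character_cong)
    qed
    show "\<exists>a. coprime a K \<and> f i a = -1 \<and> (\<forall>j\<in>I - {i}. f j a = 1)" if i: "i \<in> I" for i
    proof -
      have "\<exists>g. i \<in> P' \<longrightarrow> Legendre (int g) (int i) = -1" using exists_nonresidue P'(3) by metis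
      then obtain g where g: "i \<in> P' \<Longrightarrow> Legendre (int g) (int i) = -1" by blast
      \<comment> \<open>Of the characters of conductor 4 and 8, only the first is negative at 7,
        only the second at 5, and neither at 1.\<close>
      define u :: nat where "u = (if i = 0 then 7 else if i = 2 then 5 else 1)"
      have "u < 8" by (simp add: u_def)
      then obtain a where a: "a mod 8 = u" "\<forall>p\<in>P'. [a = (if p = i then g else 1)] (mod p)"
        using crt[of u "\<lambda>p. if p = i then g else 1"] by blast
      have Leg: "Legendre (int a) (int p) = (if p = i then -1 else 1)" if p: "p \<in> P'" for p
      proof -
        have "[int a = int (if p = i then g else 1)] (mod int p)" using a(2) p by (simp only: cong_int_iff)
        hence "Legendre (int a) (int p) = Legendre (int (if p = i then g else 1)) (int p)" by (rule Legendre_cong)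
        thus ?thesis using g p Legendre_1[of p] P'(3)[OF p] by auto
      qed
      have "odd u" by (simp add: u_def)
      hence "odd a" using a(1) dvd_mod_iff[of 2 8 a] by simp
      hence "coprime a K" using Leg by (intro copI) auto
      moreover have "f j a = (if j = i then -1 else 1)" if j: "j \<in> I" for j
      proof (cases "j = 0 \<or> j = 2")
        case True
        thus ?thesis using a(1) by (auto simp: f_def quadratic_character_def u_def)
      next
        case False
        hence "j \<in> P'" using j by (simp add: I_def)
        thus ?thesis using False Leg by (simp add: f_def quadratic_character_def)
      qed
      ultimately show ?thesis using i by (intro exI[of _ a]) auto
    qed
    show "real_of_int (\<delta> i) = 1 \<or> real_of_int (\<delta> i) = -1" if "i \<in> I" for i
      using that \<epsilon>[of i] by (auto simp: \<delta>_def I_def P'_def)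
    show "l \<in> I" by (simp add: I_def P'_def)
    show "real_of_int (\<delta> l) = -1" using l2 by (simp add: \<delta>_def)
  qed
  then obtain q where q: "prime q" "coprime q K" "\<And>i. i \<in> I \<Longrightarrow> quadratic_character i q = \<delta> i"
    by (auto simp: f_def)
  show ?thesis
  proof (rule that[OF q(1)])
    have "quadratic_character 0 q = 1" "quadratic_character 2 q = (if r = 1 then 1 else -1)"
      using q(3)[of 0] q(3)[of 2] by (simp_all add: I_def \<delta>_def)
    thus "q mod 8 = r" using r odd_mod_8[OF oddK[OF q(2)]]
      by (auto simp: quadratic_character_def split: if_splits)
    fix p assume p: "p \<in> P"
    hence "p \<noteq> 0" "p \<noteq> 2" "p \<noteq> l" "p \<in> I" using P(2)[OF p] l2 by (auto simp: I_def P'_def)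
    thus "Legendre (int q) (int p) = \<epsilon> p" using q(3)[of p] by (simp add: \<delta>_def quadratic_character_def)
  qed
qed

section \<open>Three squares\<close>

lemma squarefree_nat_eq_prod_prime_factors:
  assumes "squarefree (n::nat)" "n > 0"
  shows "n = \<Prod>(prime_factors n)"
proof -
  have "n = (\<Prod>p\<in>prime_factors n. p ^ multiplicity p n)" using assms by (simp add: prime_factorization_nat)
  also have "\<dots> = \<Prod>(prime_factors n)"
  proof (rule prod.cong[OF refl])
    fix p assume p: "p \<in> prime_factors n"
    have "multiplicity p n \<le> 1"
      using assms p by (auto simp: squarefree_factorial_semiring'')
    moreover have "multiplicity p n > 0" using p by (simp add: prime_factors_multiplicity)
    ultimately have "multiplicity p n = 1" by simp
    thus "p ^ multiplicity p n = p" by simp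
  qed
  finally show ?thesis .
qed

lemma Legendre_eq_1_imp:
  assumes "Legendre a p = 1"
  obtains y where "p dvd y\<^sup>2 - a"
proof -
  have "QuadRes p a" using assms by (auto simp: Legendre_def split: if_splits)
  thus ?thesis using that by (auto simp: QuadRes_def cong_iff_dvd_diff)
qed

text \<open>At an odd p in S the symbols of -e and q agree and are nonzero, so -e q is a square mod
  p; at p = 2 one has e = 1, and 1 + q is even. These roots combine to a root mod n.\<close>

lemma sum3sq_if_Legendre:
  fixes S :: "nat set" and e n q :: nat
  assumes S: "finite S" "\<And>p. p \<in> S \<Longrightarrow> prime p" "n = \<Prod>S"
    and q: "prime q" "q mod 4 = 1" and e: "e = 1 \<or> e = 2 \<and> odd n"
    and Leg: "\<And>p. p \<in> S \<Longrightarrow> p \<noteq> 2 \<Longrightarrow> Legendre (int q) (int p) = Legendre (- int e) (int p)"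
    and n: "Legendre (int n) (int q) = 1"
  shows "sum3sq (int n)"
proof -
  have q2: "q > 2" using q prime_gt_1_nat[of q] by (cases "q = 2") auto
  have npos: "n > 0" unfolding S using S(2) by (intro prod_pos) (auto intro: prime_gt_0_nat)
  have "\<exists>y. int p dvd y\<^sup>2 + int (e * q)" if p: "p \<in> S" for p
  proof (cases "p = 2")
    case True
    have "2 dvd n" using dvd_prodI[of S 2 "\<lambda>x. x"] p True S by simp
    hence "e = 1" using e by auto
    moreover have "odd q" using q q2 prime_odd_nat by auto
    ultimately have "int 2 dvd 1\<^sup>2 + int (e * q)" by simp
    thus ?thesis unfolding True by blast
  next
    case False
    hence p2: "prime p" "p > 2" using S(2)[OF p] prime_ge_2_nat[of p] by auto
    have "\<not> int p dvd - int e" using e p2 by (auto dest!: zdvd_imp_le)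
    hence "Legendre (- int e) (int p) \<noteq> 0" by (simp add: Legendre_eq_0_iff)
    hence "Legendre (- int e * int q) (int p) = 1"
      using Legendre_mult[OF p2, of "- int e" "int q"] Leg[OF p False] Legendre_values[of "- int e" "int p"]
      by auto
    then obtain y where "int p dvd y\<^sup>2 - (- int e * int q)" by (rule Legendre_eq_1_imp)
    thus ?thesis by auto
  qed
  hence "\<exists>y. int (\<Prod>S) dvd y\<^sup>2 + int (e * q)" using S by (intro square_mod_prod_primes)
  then obtain \<alpha> where \<alpha>: "int n dvd \<alpha>\<^sup>2 + int (e * q)" using S(3) by auto
  obtain b where b: "int q dvd b\<^sup>2 - int n" using n by (rule Legendre_eq_1_imp)
  have "\<exists>\<beta>. int e * int q dvd \<beta>\<^sup>2 - int n"
  proof (cases "e = 1")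
    case False
    hence e: "e = 2" "odd n" using e by auto
    \<comment> \<open>Adding the odd q to an even root makes it odd, so its square minus n becomes
      divisible by 2 as well.\<close>
    define \<beta> where "\<beta> = (if even b then b + int q else b)"
    have "odd q" using q q2 prime_odd_nat by auto
    hence "odd \<beta>" by (simp add: \<beta>_def)
    hence "2 dvd \<beta>\<^sup>2 - int n" using e by simp
    moreover have "[\<beta> = b] (mod int q)" by (simp add: \<beta>_def cong_def)
    hence "[\<beta>\<^sup>2 - int n = b\<^sup>2 - int n] (mod int q)" by (intro cong_diff cong_pow cong_refl)
    hence "int q dvd \<beta>\<^sup>2 - int n" using b by (simp add: cong_dvd_iff)
    moreover have "coprime 2 (int q)" using \<open>odd q\<close> by simp
    ultimately have "2 * int q dvd \<beta>\<^sup>2 - int n" by (intro divides_mult)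
    thus ?thesis using e by auto
  qed (use b in auto)
  then obtain \<beta> where \<beta>: "int e * int q dvd \<beta>\<^sup>2 - int n" by blast
  have "Legendre (-1) (int q) = 1" using Legendre_minus_1[OF q(1) q2] q(2) by simp
  then obtain \<gamma> where \<gamma>: "int q dvd \<gamma>\<^sup>2 - (-1)" by (rule Legendre_eq_1_imp)
  have "\<not> int q dvd int n" using n by (auto simp flip: Legendre_eq_0_iff)
  hence "coprime n q" using q(1) prime_imp_coprime[of q n] by (simp add: coprime_commute)
  hence "coprime n (e * q)" using e by auto
  hence "coprime (int n) (int e * int q)" by (simp only: coprime_int_iff flip: of_nat_mult)
  thus ?thesis using npos q2 e \<alpha> \<beta> \<gamma>
    by (intro sum3sq_of_local_conditions[of "int n" "int q" "int e" \<alpha> \<beta> \<gamma>]) auto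
qed

lemma sum3sq_squarefree:
  fixes n :: nat
  assumes "squarefree n" and n: "n mod 4 = 1 \<or> n mod 4 = 2 \<or> n mod 8 = 3"
  shows "sum3sq (int n)"
proof -
  have npos: "n > 0" using n by (cases "n = 0") auto
  define S where "S = prime_factors n"
  define P where "P = S - {2}"
  have S: "finite S" "\<And>p. p \<in> S \<Longrightarrow> prime p" "n = \<Prod>S"
    using squarefree_nat_eq_prod_prime_factors[OF assms(1) npos] by (auto simp: S_def)
  have P: "finite P" "\<And>p. p \<in> P \<Longrightarrow> prime p \<and> p > 2"
    using S prime_ge_2_nat by (auto simp: P_def order.order_iff_strict)
  \<comment> \<open>By reciprocity the symbol of an odd n mod q is the product of the symbols of -e
    at the primes of n. With e = 1 this is 1 for n = 1 mod 4 but -1 for n = 3 mod 8, where e = 2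
    gives 1.\<close>
  define e :: nat where "e = (if n mod 8 = 3 then 2 else 1)"
  \<comment> \<open>For even n the symbol of 2 mod q has to match the product over the odd part,
    whose sign depends on its class mod 4; it is 1 for q = 1 and -1 for q = 5 mod 8. For odd n
    either class serves, and 5 is the default.\<close>
  define r :: nat where "r = (if even n \<and> \<Prod>P mod 4 = 1 then 1 else 5)"
  have Leg0: "Legendre (- int e) (int p) = 1 \<or> Legendre (- int e) (int p) = -1" if "p \<in> P" for p
  proof -
    have "\<not> int p dvd - int e" using P(2)[OF that] by (auto simp: e_def dest!: zdvd_imp_le)
    thus ?thesis using Legendre_values[of "- int e" "int p"] by (auto simp: Legendre_eq_0_iff)
  qed
  obtain q where q: "prime q" "q mod 8 = r" "\<And>p. p \<in> P \<Longrightarrow> Legendre (int q) (int p) = Legendre (- int e) (int p)"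
    using prime_with_Legendre_symbols[of P "\<lambda>p. Legendre (- int e) (int p)" r] P Leg0 r_def by metis
  have "q mod 4 = (q mod 8) mod 4" by (simp add: mod_mod_cancel)
  hence q4: "q mod 4 = 1" using q(2) by (simp add: r_def split: if_splits)
  have q2: "q > 2" using q(1) q4 prime_gt_1_nat[of q] by (cases "q = 2") auto
  have "Legendre (int (\<Prod>P)) (int q) = (\<Prod>p\<in>P. Legendre (int p) (int q))"
    using P(1) q(1) q2 by (rule Legendre_prod)
  also have "\<dots> = (\<Prod>p\<in>P. Legendre (- int e) (int p))"
  proof (rule prod.cong[OF refl])
    fix p assume p: "p \<in> P"
    have "Legendre (int q) (int p) \<noteq> 0" using q(3)[OF p] Leg0[OF p] by auto
    hence "p \<noteq> q" by (auto simp: Legendre_eq_0_iff)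
    thus "Legendre (int p) (int q) = Legendre (- int e) (int p)"
      using Legendre_reciprocity_1_mod_4[of p q] P(2)[OF p] q(1) q4 q(3)[OF p] by auto
  qed
  finally have LP: "Legendre (int (\<Prod>P)) (int q) = (\<Prod>p\<in>P. Legendre (- int e) (int p))" .
  have odd: "odd (\<Prod>P)" using prod_Legendre_minus_1 P by blast
  have "Legendre (int n) (int q) = 1"
  proof (cases "even n")
    case True
    have "2 \<in> S" using True npos by (simp add: S_def in_prime_factors_iff)
    hence "n = 2 * \<Prod>P" using S by (simp add: P_def prod.remove)
    hence "Legendre (int n) (int q) = Legendre 2 (int q) * Legendre (int (\<Prod>P)) (int q)"
      using Legendre_mult[OF q(1) q2, of 2 "int (\<Prod>P)"] by (metis of_nat_mult of_nat_numeral)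
    also have "e = 1" using True dvd_mod_iff[of 2 8 n] by (auto simp: e_def)
    hence "Legendre (int (\<Prod>P)) (int q) = (if \<Prod>P mod 4 = 1 then 1 else -1)"
      unfolding LP using prod_Legendre_minus_1[of P] P by simp
    also have "Legendre 2 (int q) = (if \<Prod>P mod 4 = 1 then 1 else -1)"
      using Legendre_2[OF q(1) q2] q(2) True by (simp add: r_def)
    finally show ?thesis by simp
  next
    case False
    hence "2 \<notin> S" by (auto simp: S_def in_prime_factors_iff)
    hence "n = \<Prod>P" using S by (simp add: P_def)
    moreover have "(\<Prod>p\<in>P. Legendre (- int e) (int p)) = 1"
    proof (cases "n mod 8 = 3")
      case True
      thus ?thesis using prod_Legendre_minus_2[of P] P \<open>n = \<Prod>P\<close> by (simp add: e_def)
    next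
      case 2: False
      hence "n mod 4 = 1" using n False by (auto simp: even_iff_mod_2_eq_zero mod_mod_cancel dest: arg_cong[of _ _ "\<lambda>x. x mod 2"])
      thus ?thesis using prod_Legendre_minus_1[of P] P \<open>n = \<Prod>P\<close> 2 by (simp add: e_def)
    qed
    ultimately show ?thesis using LP by simp
  qed
  moreover have "e = 1 \<or> e = 2 \<and> odd n" using dvd_mod_iff[of 2 8 n] by (auto simp: e_def)
  ultimately show ?thesis using S q q4
    by (intro sum3sq_if_Legendre[of S n q e]) (auto simp: P_def)
qed

lemma sum3sq_mult_square:
  assumes "sum3sq n"
  shows "sum3sq (n * k\<^sup>2)"
proof -
  obtain a b c where "n = a\<^sup>2 + b\<^sup>2 + c\<^sup>2" using assms sum3sq_def by blast
  hence "n * k\<^sup>2 = (a * k)\<^sup>2 + (b * k)\<^sup>2 + (c * k)\<^sup>2" by (simp add: power_mult_distrib algebra_simps)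
  thus ?thesis unfolding sum3sq_def by blast
qed

text \<open>Write N = m k^2 with m squarefree. Then k is odd, as otherwise 4 would divide N; so k^2
  = 1 mod 8, and m lies in the same class mod 8 as N.\<close>

theorem sum3sq_mod_8:
  fixes N :: int
  assumes "N > 0" "N mod 4 = 1 \<or> N mod 4 = 2 \<or> N mod 8 = 3"
  shows "sum3sq N"
proof -
  define m where "m = squarefree_part (nat N)"
  define k where "k = square_part (nat N)"
  have N: "N = int m * (int k)\<^sup>2"
    using squarefree_decompose[of "nat N"] assms(1) unfolding m_def k_def
    by (metis int_nat_eq less_imp_le of_nat_mult of_nat_power)
  have "odd k"
  proof
    assume "even k"
    then obtain j where "k = 2 * j" by blast
    hence "N = 4 * (int m * (int j)\<^sup>2)" unfolding N by (simp add: power_mult_distrib)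
    hence "N mod 4 = 0" by simp
    moreover have "N mod 4 = (N mod 8) mod 4" by (simp add: mod_mod_cancel)
    ultimately show False using assms(2) by auto
  qed
  have "k\<^sup>2 mod 8 = 1"
  proof -
    obtain i where i: "k = 2 * i + 1" using \<open>odd k\<close> by (elim oddE)
    obtain j where "i * (i + 1) = 2 * j" using even_mult_iff[of i "i + 1"] by (metis evenE even_Suc Suc_eq_plus1)
    hence "k\<^sup>2 = 1 + 8 * j" unfolding i power2_eq_square by (simp add: algebra_simps)
    thus ?thesis by simp
  qed
  hence "(int k)\<^sup>2 mod 8 = 1" by (metis of_nat_1 of_nat_mod of_nat_numeral of_nat_power)
  moreover have "N mod 8 = (int m mod 8 * ((int k)\<^sup>2 mod 8)) mod 8" unfolding N by (simp add: mod_mult_eq)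
  ultimately have N8: "N mod 8 = int m mod 8" by simp
  moreover have "N mod 4 = (N mod 8) mod 4" "int m mod 4 = (int m mod 8) mod 4" by (simp_all add: mod_mod_cancel)
  ultimately have N4: "N mod 4 = int m mod 4" by simp
  have "int (m mod 4) = 1 \<or> int (m mod 4) = 2 \<or> int (m mod 8) = 3"
    using assms(2) N4 N8 by (simp add: of_nat_mod)
  hence "m mod 4 = 1 \<or> m mod 4 = 2 \<or> m mod 8 = 3" by linarith
  hence "sum3sq (int m)" by (intro sum3sq_squarefree) (simp_all add: m_def)
  thus ?thesis unfolding N by (rule sum3sq_mult_square)
qed

section \<open>The form $x^2 + 2y^2 + 4z^2 + 10w^2$\<close>

lemma odd_square_mod_8: "odd a \<Longrightarrow> (a::int)\<^sup>2 mod 8 = 1"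
proof -
  assume "odd a"
  then obtain k where k: "a = 2 * k + 1" by (elim oddE)
  have "even (k * (k + 1))" by simp
  then obtain j where "k * (k + 1) = 2 * j" by blast
  hence "a\<^sup>2 = 1 + 8 * j" unfolding k power2_eq_square by (simp add: algebra_simps)
  thus ?thesis by simp
qed

lemma even_square_mod_4: "even a \<Longrightarrow> (a::int)\<^sup>2 mod 4 = 0"
  by (auto elim!: evenE simp: power2_eq_square)

lemma odd_square_mod_4: "odd a \<Longrightarrow> (a::int)\<^sup>2 mod 4 = 1"
  using odd_square_mod_8[of a] by presburger

lemma sum3sq_4k2:
  assumes "sum3sq N" "N mod 4 = 2"
  obtains a b c where "N = a\<^sup>2 + b\<^sup>2 + c\<^sup>2" "odd a" "odd b" "even c"
proof -
  obtain a b c where e: "N = a\<^sup>2 + b\<^sup>2 + c\<^sup>2" using assms sum3sq_def by blast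
  have sq: "x\<^sup>2 mod 4 = (if even x then 0 else 1)" for x :: int
    using even_square_mod_4 odd_square_mod_4 by simp
  have "N mod 4 = (a\<^sup>2 mod 4 + b\<^sup>2 mod 4 + c\<^sup>2 mod 4) mod 4"
    unfolding e by (intro mod_add_cong mod_mod_trivial[symmetric])
  hence mod4: "N mod 4 = ((if even a then 0 else 1) + (if even b then 0 else 1) + (if even c then 0 else 1)) mod 4"
    by (simp only: sq)
  have "(odd a \<and> odd b \<and> even c) \<or> (odd a \<and> even b \<and> odd c) \<or> (even a \<and> odd b \<and> odd c)"
    using mod4 assms(2) by (auto split: if_splits)
  thus ?thesis
    by (elim disjE conjE) (rule that[of a b c] that[of a c b] that[of b c a]; simp add: e)+
qed

lemma sum3sq_4k1:
  assumes "sum3sq N" "N mod 4 = 1"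
  obtains a b c where "N = a\<^sup>2 + b\<^sup>2 + c\<^sup>2" "odd a" "even b" "even c"
proof -
  obtain a b c where e: "N = a\<^sup>2 + b\<^sup>2 + c\<^sup>2" using assms sum3sq_def by blast
  have sq: "x\<^sup>2 mod 4 = (if even x then 0 else 1)" for x :: int
    using even_square_mod_4 odd_square_mod_4 by simp
  have "N mod 4 = (a\<^sup>2 mod 4 + b\<^sup>2 mod 4 + c\<^sup>2 mod 4) mod 4"
    unfolding e by (intro mod_add_cong mod_mod_trivial[symmetric])
  hence mod4: "N mod 4 = ((if even a then 0 else 1) + (if even b then 0 else 1) + (if even c then 0 else 1)) mod 4"
    by (simp only: sq)
  have "(odd a \<and> even b \<and> even c) \<or> (even a \<and> odd b \<and> even c) \<or> (even a \<and> even b \<and> odd c)"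
    using mod4 assms(2) by (auto split: if_splits)
  thus ?thesis
    by (elim disjE conjE) (rule that[of a b c] that[of b a c] that[of c a b]; simp add: e)+
qed

text \<open>Two of the three bases have equal parity, and b^2 + c^2 = 2 ((b + c)/2)^2 + 2 ((b -
  c)/2)^2.\<close>

lemma sum3sq_form_122:
  assumes "sum3sq N"
  obtains y x z where "N = y\<^sup>2 + 2 * x\<^sup>2 + 2 * z\<^sup>2"
proof -
  have *: thesis if "N = a\<^sup>2 + b\<^sup>2 + c\<^sup>2" "even (b + c)" for a b c
  proof -
    obtain k where k: "b + c = 2 * k" using \<open>even (b + c)\<close> by (elim evenE)
    hence b: "b = 2 * k - c" by simp
    have "N = a\<^sup>2 + 2 * k\<^sup>2 + 2 * (k - c)\<^sup>2"
      unfolding that(1) b by (simp add: power2_eq_square algebra_simps)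
    thus thesis by (rule \<open>\<And>x y z. N = y\<^sup>2 + 2 * x\<^sup>2 + 2 * z\<^sup>2 \<Longrightarrow> thesis\<close>)
  qed
  obtain a b c where e: "N = a\<^sup>2 + b\<^sup>2 + c\<^sup>2" using assms sum3sq_def by blast
  have "even (b + c) \<or> even (a + c) \<or> even (a + b)" by presburger
  thus ?thesis using *[of a b c] *[of b a c] *[of c a b] e by (simp add: ac_simps) blast
qed

text \<open>Halving a representation of 2 (n - 10) yields p^2 + (p - b)^2 + 2 c'^2. As n - 10 is
  odd, one of the first two bases is even and supplies 4 z^2.\<close>

lemma Q80_1_prim_rep_odd:
  assumes three: "\<And>N. N > 0 \<Longrightarrow> N mod 4 = 2 \<Longrightarrow> sum3sq N"
    and n: "odd n" "n > 10"
  shows "\<exists>x y z w. Gcd {x, y, z, w} = 1 \<and> Q80_1 x y z w = n"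
proof -
  have "2 * (n - 10) mod 4 = 2" using n by presburger
  moreover from this have "sum3sq (2 * (n - 10))" using n by (intro three) auto
  ultimately obtain a b c where e: "2 * (n - 10) = a\<^sup>2 + b\<^sup>2 + c\<^sup>2" "odd a" "odd b" "even c"
    using sum3sq_4k2 by blast
  obtain p where "a + b = 2 * p" using e by (meson evenE odd_even_add)
  hence p: "a = 2 * p - b" by simp
  obtain c' where c': "c = 2 * c'" using e by blast
  have n10: "n - 10 = p\<^sup>2 + (p - b)\<^sup>2 + 2 * c'\<^sup>2"
    using e(1) unfolding p c' by (simp add: power2_eq_square algebra_simps)
  have *: ?thesis if "n - 10 = x\<^sup>2 + (2 * z)\<^sup>2 + 2 * y\<^sup>2" for x y z
    using that by (intro exI[of _ x] exI[of _ y] exI[of _ z] exI[of _ 1]) (simp add: Q80_1_def)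
  have "odd (p\<^sup>2 + (p - b)\<^sup>2 + 2 * c'\<^sup>2)" using n by (simp flip: n10)
  hence "even p \<or> even (p - b)" by auto
  thus ?thesis
  proof
    assume "even p"
    then obtain z where "p = 2 * z" by blast
    thus ?thesis using *[of "p - b" z c'] n10 by simp
  next
    assume "even (p - b)"
    then obtain z where "p - b = 2 * z" by blast
    thus ?thesis using *[of p z c'] n10 by simp
  qed
qed

lemma Gcd4_eq_1I:
  fixes x y z w :: int
  assumes "\<And>d. d dvd x \<Longrightarrow> d dvd y \<Longrightarrow> d dvd z \<Longrightarrow> d dvd w \<Longrightarrow> is_unit d"
  shows "Gcd {x, y, z, w} = 1"
proof -
  have "is_unit (Gcd {x, y, z, w})" by (rule assms) (rule Gcd_dvd, simp)+
  thus ?thesis by (simp add: zdvd1_eq)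
qed

lemma minus_5_mod:
  fixes m :: int
  assumes "m mod 4 \<noteq> 1" "m mod 8 \<noteq> 4"
  shows "(m - 5) mod 4 = 1 \<or> (m - 5) mod 4 = 2 \<or> (m - 5) mod 8 = 3"
proof -
  have "m mod 8 = 0 \<or> m mod 8 = 1 \<or> m mod 8 = 2 \<or> m mod 8 = 3 \<or>
        m mod 8 = 4 \<or> m mod 8 = 5 \<or> m mod 8 = 6 \<or> m mod 8 = 7" by auto
  moreover have "m mod 4 = (m mod 8) mod 4" by (simp add: mod_mod_cancel)
  moreover have "(m - 5) mod 8 = (m mod 8 - 5) mod 8" by (simp add: mod_diff_left_eq)
  moreover have "(m - 5) mod 4 = ((m - 5) mod 8) mod 4" by (simp add: mod_mod_cancel)
  ultimately show ?thesis using assms by auto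
qed

text \<open>With first coordinate 2 x the form is twice y^2 + 2 x^2 + 2 z^2 + 5 w^2, so
  \<open>sum3sq_form_122\<close> applies to m - 5 w^2. The listed m are those for which this
  difference would not be positive.\<close>

lemma Q80_1_prim_rep_even:
  assumes three: "\<And>N. N > 0 \<Longrightarrow> N mod 4 = 1 \<or> N mod 4 = 2 \<or> N mod 8 = 3 \<Longrightarrow> sum3sq N"
    and n: "n = 2 * m" "m > 0" "m mod 8 \<noteq> 4" "m \<notin> {1, 2, 3, 5, 9, 13, 17}"
  shows "\<exists>x y z w. Gcd {x, y, z, w} = 1 \<and> Q80_1 x y z w = n"
proof (cases "m mod 4 = 1")
  case True
  have "m > 20"
  proof (rule ccontr)
    assume "\<not> m > 20"
    hence "m = 1 \<or> m = 5 \<or> m = 9 \<or> m = 13 \<or> m = 17" using n(2) True by presburger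
    thus False using n by auto
  qed
  moreover have "(m - 20) mod 4 = 1" using True by presburger
  ultimately have "sum3sq (m - 20)" by (intro three) auto
  then obtain y x z where e: "m - 20 = y\<^sup>2 + 2 * x\<^sup>2 + 2 * z\<^sup>2" by (rule sum3sq_form_122)
  have "odd (m - 20)" using True by presburger
  hence "odd y" unfolding e by simp
  have "Gcd {2 * x, y, z, 2} = 1"
  proof (rule Gcd4_eq_1I)
    fix d assume "d dvd y" "d dvd 2"
    thus "is_unit d" using \<open>odd y\<close> by (metis coprime_common_divisor coprime_left_2_iff_odd)
  qed
  moreover have "Q80_1 (2 * x) y z 2 = n" using e n(1) by (simp add: Q80_1_def power2_eq_square)
  ultimately show ?thesis by blast
next
  case False
  have "m > 5"
  proof (rule ccontr)
    assume "\<not> m > 5"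
    hence "m = 1 \<or> m = 2 \<or> m = 3 \<or> m = 4 \<or> m = 5" using n(2) by arith
    thus False using n by auto
  qed
  moreover have "(m - 5) mod 4 = 1 \<or> (m - 5) mod 4 = 2 \<or> (m - 5) mod 8 = 3"
    using False n(3) by (rule minus_5_mod)
  ultimately have "sum3sq (m - 5)" by (intro three) auto
  then obtain y x z where e: "m - 5 = y\<^sup>2 + 2 * x\<^sup>2 + 2 * z\<^sup>2" by (rule sum3sq_form_122)
  have "Q80_1 (2 * x) y z 1 = n" using e n(1) by (simp add: Q80_1_def power2_eq_square)
  thus ?thesis by (intro exI[of _ "2*x"] exI[of _ y] exI[of _ z] exI[of _ 1]) simp
qed

text \<open>The substitution rests on (2 (a + b))^2 + 4 (a - b)^2 = 8 (a^2 + b^2). A common divisor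
  of the coordinates divides the odd a - b, so it is odd and divides w, which is 1 or 2.\<close>

lemma Q80_1_prim_rep_8:
  assumes three: "\<And>N. N > 0 \<Longrightarrow> N mod 4 = 1 \<or> N mod 4 = 2 \<Longrightarrow> sum3sq N"
    and n: "n = 8 * m" "m > 0" "odd m" "m \<notin> {1, 3, 5, 9, 13, 17}"
  shows "\<exists>x y z w. Gcd {x, y, z, w} = 1 \<and> Q80_1 x y z w = n"
proof -
  have *: ?thesis if e: "m = a\<^sup>2 + b\<^sup>2 + c\<^sup>2 + 5 * w\<^sup>2" and odd: "odd a" "even b" and w: "w = 1 \<or> w = 2 \<and> even c"
    for a b c w
  proof -
    have "Gcd {2 * (a + b), 2 * c, a - b, 2 * w} = 1"
    proof (rule Gcd4_eq_1I)
      fix d assume d: "d dvd a - b" "d dvd 2 * w"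
      have "odd d" using d(1) odd dvd_trans[of 2 d "a - b"] by auto
      hence c2: "coprime d 2" by simp
      hence "d dvd w" using d(2) by (simp add: coprime_dvd_mult_right_iff)
      hence "d dvd 1" using c2 w by (metis coprime_def dvd_refl)
      thus "is_unit d" .
    qed
    moreover have "Q80_1 (2 * (a + b)) (2 * c) (a - b) (2 * w) = n"
      using e n(1) by (simp add: Q80_1_def power2_eq_square algebra_simps)
    ultimately show ?thesis by blast
  qed
  show ?thesis
  proof (cases "m mod 4 = 1")
    case True
    have "m > 20"
    proof (rule ccontr)
      assume "\<not> m > 20"
      hence "m = 1 \<or> m = 5 \<or> m = 9 \<or> m = 13 \<or> m = 17" using n(2) True by presburger
      thus False using n by auto
    qed
    moreover have **: "(m - 20) mod 4 = 1" using True by presburger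
    ultimately have "sum3sq (m - 20)" by (intro three) auto
    then obtain a b c where "m - 20 = a\<^sup>2 + b\<^sup>2 + c\<^sup>2" "odd a" "even b" "even c"
      using ** by (rule sum3sq_4k1)
    thus ?thesis by (intro *[of a b c 2]) auto
  next
    case False
    have "m > 5"
    proof (rule ccontr)
      assume "\<not> m > 5"
      hence "m = 1 \<or> m = 2 \<or> m = 3 \<or> m = 4 \<or> m = 5" using n(2) by arith
      thus False using n by auto
    qed
    moreover have **: "(m - 5) mod 4 = 2" using False n(3) by presburger
    ultimately have "sum3sq (m - 5)" by (intro three) auto
    then obtain a b c where "m - 5 = a\<^sup>2 + b\<^sup>2 + c\<^sup>2" "odd a" "odd b" "even c"
      using ** by (rule sum3sq_4k2)
    \<comment> \<open>Two entries are odd and one is even; the even one is paired with an odd one to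
      make the difference odd.\<close>
    thus ?thesis by (intro *[of a c b 1]) auto
  qed
qed

lemma Q80_1_24_imprimitive:
  assumes "Q80_1 x y z w = 24"
  shows "even x \<and> even y \<and> even z \<and> even w"
proof -
  have e: "x\<^sup>2 + 2 * y\<^sup>2 + 4 * z\<^sup>2 + 10 * w\<^sup>2 = 24" using assms by (simp add: Q80_1_def)
  have nn: "x\<^sup>2 \<ge> 0" "y\<^sup>2 \<ge> 0" "z\<^sup>2 \<ge> 0" "w\<^sup>2 \<ge> 0" by auto
  have "x\<^sup>2 < 25" "y\<^sup>2 < 16" "z\<^sup>2 < 9" "w\<^sup>2 < 4" using e nn by linarith+
  hence "x\<^sup>2 < 5\<^sup>2" "y\<^sup>2 < 4\<^sup>2" "z\<^sup>2 < 3\<^sup>2" "w\<^sup>2 < 2\<^sup>2" by simp_all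
  hence "\<bar>x\<bar> < 5" "\<bar>y\<bar> < 4" "\<bar>z\<bar> < 3" "\<bar>w\<bar> < 2"
    using power2_less_imp_less[of "\<bar>x\<bar>" 5] power2_less_imp_less[of "\<bar>y\<bar>" 4]
      power2_less_imp_less[of "\<bar>z\<bar>" 3] power2_less_imp_less[of "\<bar>w\<bar>" 2] by simp_all
  moreover have "t\<^sup>2 \<in> {0, 1}" if "\<bar>t\<bar> < 2" for t :: int
  proof -
    have "t = -1 \<or> t = 0 \<or> t = 1" using that by arith
    thus ?thesis by auto
  qed
  moreover have "t\<^sup>2 \<in> {0, 1, 4}" if "\<bar>t\<bar> < 3" for t :: int
  proof -
    have "t = -2 \<or> t = -1 \<or> t = 0 \<or> t = 1 \<or> t = 2" using that by arith
    thus ?thesis by auto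
  qed
  moreover have "t\<^sup>2 \<in> {0, 1, 4, 9}" if "\<bar>t\<bar> < 4" for t :: int
  proof -
    have "t = -3 \<or> t = -2 \<or> t = -1 \<or> t = 0 \<or> t = 1 \<or> t = 2 \<or> t = 3" using that by arith
    thus ?thesis by auto
  qed
  moreover have "t\<^sup>2 \<in> {0, 1, 4, 9, 16}" if "\<bar>t\<bar> < 5" for t :: int
  proof -
    have "t = -4 \<or> t = -3 \<or> t = -2 \<or> t = -1 \<or> t = 0 \<or> t = 1 \<or> t = 2 \<or> t = 3 \<or> t = 4" using that by arith
    thus ?thesis by auto
  qed
  ultimately have "x\<^sup>2 \<in> {0, 1, 4, 9, 16}" "y\<^sup>2 \<in> {0, 1, 4, 9}" "z\<^sup>2 \<in> {0, 1, 4}" "w\<^sup>2 \<in> {0, 1}"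
    by blast+
  \<comment> \<open>Generalising the squares to variables ranging over finite lists leaves a finite
    check.\<close>
  moreover have "even X \<and> even Y \<and> even Z \<and> even W" if "X + 2 * Y + 4 * Z + 10 * W = 24"
    "X \<in> {0, 1, 4, 9, 16}" "Y \<in> {0, 1, 4, 9}" "Z \<in> {0, 1, 4}" "W \<in> {0, 1}" for X Y Z W :: int
    using that by (elim insertE emptyE; hypsubst; simp)
  ultimately have "even (x\<^sup>2) \<and> even (y\<^sup>2) \<and> even (z\<^sup>2) \<and> even (w\<^sup>2)"
    using e by blast
  thus ?thesis by simp
qed

theorem theorem4p8:
  shows "(\<forall>n::int. n > 0 \<and> n \<noteq> 24 \<longrightarrow> primitively_represents Q80_1 n)
       \<and> \<not> primitively_represents Q80_1 24"
proof (intro conjI allI impI)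
  fix n :: int assume n: "n > 0 \<and> n \<noteq> 24"
  have I: "primitively_represents Q80_1 n"
    if "\<exists>x y z w. Gcd {x, y, z, w} = 1 \<and> Q80_1 x y z w = n"
    using that by (simp add: primitively_represents_def)
  have W: "primitively_represents Q80_1 n" if "Gcd {x, y, z, w} = 1" "Q80_1 x y z w = n" for x y z w
    using that unfolding primitively_represents_def by blast
  show "primitively_represents Q80_1 n"
  proof (cases "even n")
    case False
    show ?thesis
    proof (cases "n > 10")
      case True
      with False show ?thesis by (intro I Q80_1_prim_rep_odd sum3sq_mod_8) auto
    next
      case small: False
      have "n = 1 \<or> n = 3 \<or> n = 5 \<or> n = 7 \<or> n = 9" using n small False by presburger
      thus ?thesis
        using W[of 1 0 0 0] W[of 1 1 0 0] W[of 1 0 1 0] W[of 1 1 1 0] W[of 1 2 0 0]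
        by (elim disjE) (simp_all add: Q80_1_def)
    qed
  next
    case True
    then obtain m where m: "n = 2 * m" by blast
    show ?thesis
    proof (cases "m \<in> {1, 2, 3, 5, 9, 13, 17}")
      case True
      thus ?thesis
        using W[of 0 1 0 0] W[of 0 0 1 0] W[of 0 1 1 0] W[of 0 0 0 1] W[of 0 1 2 0] W[of 0 0 2 1] W[of 0 2 2 1]
        unfolding m by (elim insertE emptyE) (simp_all add: Q80_1_def)
    next
      case False
      show ?thesis
      proof (cases "m mod 8 = 4")
        case True
        then obtain k where k: "m = 8 * k + 4" by (metis mult_div_mod_eq)
        define M where "M = 2 * k + 1"
        have M: "n = 8 * M" "odd M" "M > 0" using n by (auto simp: m k M_def)
        show ?thesis
        proof (cases "M \<in> {1, 3, 5, 9, 13, 17}")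
          case True
          thus ?thesis
            \<comment> \<open>The value 3 is the excluded n = 24; the other witnesses all have x = 2
              and z odd.\<close>
            using W[of 2 0 1 0] W[of 2 0 3 0] W[of 2 4 3 0] W[of 2 0 5 0] W[of 2 4 5 0] n
            unfolding M(1) by (elim insertE emptyE) (simp_all add: Q80_1_def)
        next
          case False
          with M show ?thesis by (intro I Q80_1_prim_rep_8 sum3sq_mod_8) auto
        qed
      qed (use n m False in \<open>intro I Q80_1_prim_rep_even sum3sq_mod_8; auto\<close>)
    qed
  qed
next
  show "\<not> primitively_represents Q80_1 24"
  proof
    assume "primitively_represents Q80_1 24"
    then obtain x y z w where *: "Gcd {x, y, z, w} = 1" "Q80_1 x y z w = 24"
      unfolding primitively_represents_def by blast
    have "2 dvd Gcd {x, y, z, w}" using Q80_1_24_imprimitive[OF *(2)] by (intro Gcd_greatest) auto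
    thus False unfolding *(1) by simp
  qed
qed

end
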